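(* Let $n\geq 1$. For any integer $\ell\geq 1$, there exists $\omega_\ell\geq 0$ such that the function $$(\omega_\ell,+\infty)\to (1/C_\infty,1/C_0),\qquad \omega\mapsto \frac{k_\ell(\omega)}{\omega}$$ is analytic, bijective, and increasing.
   Context: Medium. Let $n\geq1$ be an integer, $0=H_1<H_2<\dots<H_{n+1}<H_{n+2}=+\infty$, $T_j=H_{j+1}-H_j\in(0,+\infty]$, and $\mu_j,\rho_j>0$ for $1\leq j\leq n+1$. Put $C_j=\sqrt{\mu_j/\rho_j}$, $C_0=\min_{1\leq j\leq n+1}C_j$, $C_\infty=C_{n+1}$. Standing assumption: $C_0<C_\infty$ (no monotonicity of the $C_j$ is assumed). Dispersion function. For $\omega>0$ and real $k$, let $\nu_j=\nu_j(\omega,k)=\omega\sqrt{k^2\omega^{-2}-C_j^{-2}}$, where the square root of a nonnegative number is the nonnegative one and $\sqrt{-a}=-i\sqrt a$ for $a>0$. Define $P_0=1$, $Q_0=0$ and, for $1\leq m\leq n$, $\begin{pmatrix}P_m\\Q_m\end{pmatrix}=M_m\begin{pmatrix}P_{m-1}\\Q_{m-1}\end{pmatrix}$, where $M_m=\begin{pmatrix}\cosh(\nu_mT_m)&\sinh(\nu_mT_m)/(\mu_m\nu_m)\\ \mu_m\nu_m\sinh(\nu_mT_m)&\cosh(\nu_mT_m)\end{pmatrix}$ if $\nu_m\neq0$ and $M_m=\begin{pmatrix}1&T_m/\mu_m\\0&1\end{pmatrix}$ if $\nu_m=0$. Set $f_n(\omega,k)=\mu_{n+1}\nu_{n+1}P_n+Q_n$.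 Branches. For $\omega>0$, $k_1(\omega)>k_2(\omega)>\cdots$ denote, in decreasing order, the (finitely many) values $k\in[\omega/C_\infty,\omega/C_0)$ with $f_n(\omega,k)=0$; $k_\ell(\omega)$ is undefined if there are fewer than $\ell$ such values. *)

theory Defs
  imports "HOL-Analysis.Analysis"
begin

text \<open>
  A medium is given by the number n of bounded layers, the interface depths H and the coefficients
  mu, rho. The depths are extended reals because H (n + 2) is infinite: layer n + 1 is a half-space.
\<close>

definition medium :: "nat \<Rightarrow> (nat \<Rightarrow> ereal) \<Rightarrow> (nat \<Rightarrow> real) \<Rightarrow> (nat \<Rightarrow> real) \<Rightarrow> bool" where
  "medium n H mu rho \<longleftrightarrow>
     1 \<le> n \<and> H 1 = 0 \<and> (\<forall>j\<in>{1..n+1}. H j < H (j + 1)) \<and> H (n + 2) = \<infinity> \<and>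
     (\<forall>j\<in>{1..n+1}. 0 < mu j \<and> 0 < rho j)"

definition thickness :: "(nat \<Rightarrow> ereal) \<Rightarrow> nat \<Rightarrow> ereal" where
  "thickness H j = H (j + 1) - H j"

definition speed :: "(nat \<Rightarrow> real) \<Rightarrow> (nat \<Rightarrow> real) \<Rightarrow> nat \<Rightarrow> real" where
  "speed mu rho j = sqrt (mu j / rho j)"

definition speed_min :: "nat \<Rightarrow> (nat \<Rightarrow> real) \<Rightarrow> (nat \<Rightarrow> real) \<Rightarrow> real" where
  "speed_min n mu rho = Min (speed mu rho ` {1..n+1})"

definition speed_inf :: "nat \<Rightarrow> (nat \<Rightarrow> real) \<Rightarrow> (nat \<Rightarrow> real) \<Rightarrow> real" where
  "speed_inf n mu rho = speed mu rho (n + 1)"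

text \<open>
  The branch of the square root is not that of \<^const>\<open>csqrt\<close>: negative reals are sent to the
  negative imaginary axis.
\<close>

definition sqrt_neg :: "real \<Rightarrow> complex" where
  "sqrt_neg x = (if 0 \<le> x then complex_of_real (sqrt x) else - \<i> * complex_of_real (sqrt (- x)))"

definition nu :: "(nat \<Rightarrow> real) \<Rightarrow> (nat \<Rightarrow> real) \<Rightarrow> real \<Rightarrow> real \<Rightarrow> nat \<Rightarrow> complex" where
  "nu mu rho \<omega> k j =
     complex_of_real \<omega> * sqrt_neg (k\<^sup>2 / \<omega>\<^sup>2 - 1 / (speed mu rho j)\<^sup>2)"

text \<open>
  Only layers 1 to n have a transfer matrix; their thickness is finite, so \<^const>\<open>real_of_ereal\<close>
  loses nothing there.
\<close>

definition transfer ::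
  "(nat \<Rightarrow> ereal) \<Rightarrow> (nat \<Rightarrow> real) \<Rightarrow> (nat \<Rightarrow> real) \<Rightarrow> real \<Rightarrow> real \<Rightarrow> nat \<Rightarrow> complex^2^2" where
  "transfer H mu rho \<omega> k m =
     (let \<nu> = nu mu rho \<omega> k m;
          \<mu> = complex_of_real (mu m);
          T = complex_of_real (real_of_ereal (thickness H m))
      in if \<nu> \<noteq> 0
         then vector [vector [cosh (\<nu> * T), sinh (\<nu> * T) / (\<mu> * \<nu>)],
                      vector [\<mu> * \<nu> * sinh (\<nu> * T), cosh (\<nu> * T)]]
         else vector [vector [1, T / \<mu>],
                      vector [0, 1]])"

fun PQ ::
  "(nat \<Rightarrow> ereal) \<Rightarrow> (nat \<Rightarrow> real) \<Rightarrow> (nat \<Rightarrow> real) \<Rightarrow> real \<Rightarrow> real \<Rightarrow> nat \<Rightarrow> complex^2" where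
  "PQ H mu rho \<omega> k 0 = vector [1, 0]"
| "PQ H mu rho \<omega> k (Suc m) = transfer H mu rho \<omega> k (Suc m) *v PQ H mu rho \<omega> k m"

definition dispersion ::
  "nat \<Rightarrow> (nat \<Rightarrow> ereal) \<Rightarrow> (nat \<Rightarrow> real) \<Rightarrow> (nat \<Rightarrow> real) \<Rightarrow> real \<Rightarrow> real \<Rightarrow> complex" where
  "dispersion n H mu rho \<omega> k =
     complex_of_real (mu (n + 1)) * nu mu rho \<omega> k (n + 1) * PQ H mu rho \<omega> k n $ 1
       + PQ H mu rho \<omega> k n $ 2"

definition wavenumbers ::
  "nat \<Rightarrow> (nat \<Rightarrow> ereal) \<Rightarrow> (nat \<Rightarrow> real) \<Rightarrow> (nat \<Rightarrow> real) \<Rightarrow> real \<Rightarrow> real set" where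
  "wavenumbers n H mu rho \<omega> =
     {k \<in> {\<omega> / speed_inf n mu rho ..< \<omega> / speed_min n mu rho}. dispersion n H mu rho \<omega> k = 0}"

definition branch_defined ::
  "nat \<Rightarrow> (nat \<Rightarrow> ereal) \<Rightarrow> (nat \<Rightarrow> real) \<Rightarrow> (nat \<Rightarrow> real) \<Rightarrow> nat \<Rightarrow> real \<Rightarrow> bool" where
  "branch_defined n H mu rho l \<omega> \<longleftrightarrow>
     finite (wavenumbers n H mu rho \<omega>) \<and> 1 \<le> l \<and> l \<le> card (wavenumbers n H mu rho \<omega>)"

text \<open>The l-th largest wavenumber, counted from l = 1; meaningful only under
  \<^const>\<open>branch_defined\<close>.\<close>

definition branch ::
  "nat \<Rightarrow> (nat \<Rightarrow> ereal) \<Rightarrow> (nat \<Rightarrow> real) \<Rightarrow> (nat \<Rightarrow> real) \<Rightarrow> nat \<Rightarrow> real \<Rightarrow> real" where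
  "branch n H mu rho l \<omega> = rev (sorted_list_of_set (wavenumbers n H mu rho \<omega>)) ! (l - 1)"

text \<open>Real analyticity: near every point of S the function is the sum of a power series.\<close>

definition real_analytic_on :: "(real \<Rightarrow> real) \<Rightarrow> real set \<Rightarrow> bool" where
  "real_analytic_on f S \<longleftrightarrow>
     (\<forall>x\<in>S. \<exists>r>0. \<exists>a::nat \<Rightarrow> real. \<forall>y. \<bar>y - x\<bar> < r \<longrightarrow> (\<lambda>i. a i * (y - x) ^ i) sums f y)"

end

theory Submission
  imports Defs "HOL-Complex_Analysis.Complex_Analysis"
begin

text \<open>
  Write \<open>k = \<omega> s\<close>. In layer \<open>j\<close>, put \<open>a = \<omega>\<^sup>2 / \<mu>\<close> and \<open>b = \<mu> (p\<^sup>2 - s\<^sup>2)\<close> with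
  \<open>p = 1 / C\<close>; then \<open>u = P\<close> and \<open>y = - Q / \<omega>\<^sup>2\<close> are the solution of \<open>u' = - a y\<close>, \<open>y' = b u\<close> starting at
  \<open>(1, 0)\<close> at the surface. The polar angle \<open>\<psi>\<close> of \<open>(u, y)\<close> obeys \<open>\<psi>' = a sin\<^sup>2 \<psi> + b cos\<^sup>2 \<psi>\<close>, so it
  increases with the coefficients \<open>a\<close> and \<open>b\<close>, hence with \<open>\<omega>\<close>, and decreases in \<open>s\<close>. The scaling of
  \<open>Q\<close> by \<open>\<omega>\<^sup>2\<close> is what makes this work: with \<open>Q\<close> or \<open>Q / \<omega>\<close> instead, the layers with \<open>b < 0\<close> would
  push the angle the other way when \<open>\<omega>\<close> grows.

  The dispersion equation says \<open>tan \<psi> = \<mu> sqrt (s\<^sup>2 - p\<^sup>2) / \<omega>\<close> at the base, with the half-space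
  values of \<open>\<mu>\<close> and \<open>p\<close>. Equivalently, the phase \<open>\<psi> - arctan (\<mu> sqrt (s\<^sup>2 - p\<^sup>2) / \<omega>)\<close> is an integer multiple
  of \<open>\<pi>\<close>. The arctangent turns the monotonicity of \<open>\<psi>\<close> into strict monotonicity of the phase, in \<open>s\<close>
  and, for \<open>s > p\<close>, in \<open>\<omega>\<close>. At \<open>s = 1 / C\<^sub>0\<close> no layer oscillates and the phase lies in
  \<open>(- \<pi>, 0)\<close>; so the roots at frequency \<open>\<omega>\<close> are the points where the phase equals \<open>0, \<pi>, 2 \<pi>, \<dots>\<close>,
  in decreasing order, and the \<open>l\<close>-th branch is the level set of height \<open>(l - 1) \<pi>\<close>. As a
  level set of a function increasing in \<open>\<omega>\<close> and decreasing in \<open>s\<close>, it is an increasing curve. It reaches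
  every \<open>s\<close> between \<open>1 / C\<^sub>\<infinity>\<close> and \<open>1 / C\<^sub>0\<close> because at such an \<open>s\<close> the phase is negative for small
  \<open>\<omega>\<close> and tends to infinity with \<open>\<omega>\<close>: a slowest layer keeps turning the vector \<open>(u, y)\<close>, while no
  layer turns it back by more than \<open>\<pi>\<close>.

  Analyticity follows from the complex implicit function theorem, applied to the dispersion function
  extended to complex \<open>\<omega>\<close> and \<open>s\<close>. The roots are simple: the \<open>s\<close>-derivative of \<open>\<psi>\<close> is the Wronskian
  \<open>u \<partial>\<^sub>s y - y \<partial>\<^sub>s u\<close> over \<open>u\<^sup>2 + y\<^sup>2\<close>, which is not positive, and the square root
  contributes a term of one strict sign.
\<close>

section \<open>Hyperbolic functions of a square root\<close>

text \<open>
  The entire functions \<open>cosh \<surd>z\<close> and \<open>sinh \<surd>z / \<surd>z\<close>. Written in terms of the square \<open>z = \<nu>\<^sup>2 T\<^sup>2\<close>, the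
  transfer matrices need no choice of a square root and no separate case \<open>\<nu> = 0\<close>, they are real at real
  arguments, and they depend holomorphically on the parameters. The type is generic because the
  angle argument lives over the reals and the implicit function theorem over the complex numbers.
\<close>

definition cosh_sqrt :: "'a::{real_normed_field,banach} \<Rightarrow> 'a" where
  "cosh_sqrt z = (\<Sum>i. inverse (fact (2 * i)) * z ^ i)"

definition sinhc_sqrt :: "'a::{real_normed_field,banach} \<Rightarrow> 'a" where
  "sinhc_sqrt z = (\<Sum>i. inverse (fact (2 * i + 1)) * z ^ i)"

lemma summable_power_over_fact:
  fixes z :: "'a::{real_normed_field,banach}"
  assumes "\<And>i. i \<le> m i"
  shows "summable (\<lambda>i. inverse (fact (m i)) * z ^ i)"
proof (rule summable_comparison_test)
  show "summable (\<lambda>i. inverse (fact i) * norm z ^ i)"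
    by (rule summable_exp)
  have "norm (inverse (fact (m i)) * z ^ i) \<le> inverse (fact i) * norm z ^ i" for i
  proof -
    have "(fact i :: real) \<le> fact (m i)"
      by (rule fact_mono[OF assms])
    then have "inverse (fact (m i) :: real) \<le> inverse (fact i)"
      by (intro le_imp_inverse_le) auto
    then show ?thesis
      by (simp add: norm_mult norm_inverse norm_power mult_right_mono)
  qed
  then show "\<exists>N. \<forall>i\<ge>N. norm (inverse (fact (m i)) * z ^ i) \<le> inverse (fact i) * norm z ^ i"
    by blast
qed

lemma cosh_sqrt_sums: "(\<lambda>i. inverse (fact (2 * i)) * z ^ i) sums cosh_sqrt z"
  for z :: "'a::{real_normed_field,banach}"
  unfolding cosh_sqrt_def by (rule summable_sums[OF summable_power_over_fact]) simp

lemma sinhc_sqrt_sums: "(\<lambda>i. inverse (fact (2 * i + 1)) * z ^ i) sums sinhc_sqrt z"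
  for z :: "'a::{real_normed_field,banach}"
  unfolding sinhc_sqrt_def by (rule summable_sums[OF summable_power_over_fact]) simp

lemma cosh_sqrt_0 [simp]: "cosh_sqrt 0 = 1"
  using powser_sums_zero_iff[of "\<lambda>i. inverse (fact (2 * i))" "cosh_sqrt 0"] cosh_sqrt_sums[of 0]
  by simp

lemma sinhc_sqrt_0 [simp]: "sinhc_sqrt 0 = 1"
  using powser_sums_zero_iff[of "\<lambda>i. inverse (fact (2 * i + 1))" "sinhc_sqrt 0"] sinhc_sqrt_sums[of 0]
  by simp

lemma cosh_sqrt_square: "cosh_sqrt (w\<^sup>2) = cosh w"
  for w :: "'a::{real_normed_field,banach}"
proof -
  let ?f = "\<lambda>i. if even i then w ^ i /\<^sub>R fact i else 0"
  have "?f (2 * i) = inverse (fact (2 * i)) * (w\<^sup>2) ^ i" for i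
    by (simp add: scaleR_conv_of_real flip: power_mult)
  moreover have "(\<lambda>i. ?f (2 * i)) sums cosh w"
    by (subst sums_mono_reindex[of "\<lambda>i. 2 * i"])
      (auto simp: strict_mono_def intro: cosh_converges elim!: evenE)
  ultimately have "(\<lambda>i. inverse (fact (2 * i)) * (w\<^sup>2) ^ i) sums cosh w"
    by simp
  then show ?thesis
    by (rule sums_unique2[OF cosh_sqrt_sums])
qed

lemma sinhc_sqrt_square: "w * sinhc_sqrt (w\<^sup>2) = sinh w"
  for w :: "'a::{real_normed_field,banach}"
proof -
  let ?f = "\<lambda>i. if even i then 0 else w ^ i /\<^sub>R fact i"
  have "?f (2 * i + 1) = w * (inverse (fact (2 * i + 1)) * (w\<^sup>2) ^ i)" for i
    by (simp add: scaleR_conv_of_real del: fact_Suc flip: power_mult)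
  moreover have "(\<lambda>i. ?f (2 * i + 1)) sums sinh w"
    by (subst sums_mono_reindex[of "\<lambda>i. 2 * i + 1"])
      (auto simp: strict_mono_def intro: sinh_converges elim!: oddE)
  ultimately have "(\<lambda>i. w * (inverse (fact (2 * i + 1)) * (w\<^sup>2) ^ i)) sums sinh w"
    by simp
  moreover have "(\<lambda>i. w * (inverse (fact (2 * i + 1)) * (w\<^sup>2) ^ i)) sums (w * sinhc_sqrt (w\<^sup>2))"
    by (intro sums_mult sinhc_sqrt_sums)
  ultimately show ?thesis
    by (rule sums_unique2[symmetric])
qed

lemma cosh_sqrt_of_real: "cosh_sqrt (complex_of_real x) = of_real (cosh_sqrt x)"
proof -
  have "(\<lambda>i. of_real (inverse (fact (2 * i)) * x ^ i)) sums (complex_of_real (cosh_sqrt x))"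
    by (intro sums_of_real cosh_sqrt_sums)
  then show ?thesis
    using cosh_sqrt_sums[of "complex_of_real x"] by (auto dest: sums_unique2)
qed

lemma sinhc_sqrt_of_real: "sinhc_sqrt (complex_of_real x) = of_real (sinhc_sqrt x)"
proof -
  have "(\<lambda>i. of_real (inverse (fact (2 * i + 1)) * x ^ i)) sums (complex_of_real (sinhc_sqrt x))"
    by (intro sums_of_real sinhc_sqrt_sums)
  then show ?thesis
    using sinhc_sqrt_sums[of "complex_of_real x"] 
    by (auto dest: sums_unique2 simp del: fact_Suc simp add: of_real_inverse of_real_mult)
qed

lemma has_field_derivative_cosh_sqrt: "(cosh_sqrt has_field_derivative sinhc_sqrt z / 2) (at z)"
  for z :: "'a::{real_normed_field,banach}"
proof -
  have "(cosh_sqrt has_field_derivative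
      (\<Sum>i. diffs (\<lambda>i. inverse (fact (2 * i))) i * z ^ i)) (at z)"
    unfolding cosh_sqrt_def[abs_def]
    by (rule termdiffs_strong_converges_everywhere) (rule summable_power_over_fact, simp)
  moreover have "diffs (\<lambda>i. inverse (fact (2 * i))) i * z ^ i
      = inverse (fact (2 * i + 1)) * z ^ i / 2" for i
  proof -
    have "2 * Suc i = Suc (2 * i + 1)"
      by simp
    then have "(fact (2 * Suc i) :: 'a) = of_nat (2 * Suc i) * fact (2 * i + 1)"
      by (metis fact_Suc)
    then have "(fact (2 * Suc i) :: 'a) = 2 * of_nat (Suc i) * fact (2 * i + 1)"
      by (simp only: of_nat_mult of_nat_numeral)
    then show ?thesis
      by (simp add: diffs_def nonzero_divide_eq_eq nonzero_inverse_mult_distrib del: fact_Suc of_nat_Suc mult_Suc_right)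
  qed
  moreover have "(\<lambda>i. inverse (fact (2 * i + 1)) * z ^ i / 2) sums (sinhc_sqrt z / 2)"
    by (intro sums_divide sinhc_sqrt_sums)
  ultimately show ?thesis
    by (simp only: sums_iff)
qed

text \<open>
  The relation between the two functions and the derivative is stated without dividing by \<open>z\<close>, so that it covers
  \<open>z = 0\<close>, the case of a layer with \<open>\<nu> = 0\<close>.
\<close>

lemma has_field_derivative_sinhc_sqrt:
  fixes z :: "'a::{real_normed_field,banach}"
  obtains d where "(sinhc_sqrt has_field_derivative d) (at z)"
    "sinhc_sqrt z + 2 * z * d = cosh_sqrt z"
proof
  let ?c = "\<lambda>i. inverse (fact (2 * i + 1)) :: 'a"
  let ?d = "\<Sum>i. diffs ?c i * z ^ i"
  have summable: "summable (\<lambda>i. ?c i * y ^ i)" for y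
    by (rule summable_power_over_fact) simp
  show "(sinhc_sqrt has_field_derivative ?d) (at z)"
    unfolding sinhc_sqrt_def[abs_def]
    by (rule termdiffs_strong_converges_everywhere[OF summable])
  have "summable (\<lambda>i. diffs ?c i * z ^ i)"
    by (rule termdiff_converges_all[OF summable])
  then have "(\<lambda>i. of_nat i * ?c i * z ^ (i - Suc 0)) sums ?d"
    by (rule diffs_equiv)
  then have "(\<lambda>i. ?c i * z ^ i + 2 * z * (of_nat i * ?c i * z ^ (i - Suc 0)))
      sums (sinhc_sqrt z + 2 * z * ?d)"
    by (intro sums_add sums_mult sinhc_sqrt_sums)
  moreover have "?c i * z ^ i + 2 * z * (of_nat i * ?c i * z ^ (i - Suc 0))
      = inverse (fact (2 * i)) * z ^ i" for i
  proof -
    have "z * z ^ (i - Suc 0) * of_nat i = z ^ i * of_nat i"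
      by (cases i) auto
    then have "?c i * z ^ i + 2 * z * (of_nat i * ?c i * z ^ (i - Suc 0))
        = ?c i * of_nat (2 * i + 1) * z ^ i"
      by (simp add: algebra_simps del: fact_Suc)
    also have "?c i * of_nat (2 * i + 1) = inverse (fact (2 * i))"
    proof -
      have "of_nat (2 * i + 1) \<noteq> (0::'a)"
        by (metis Suc_eq_plus1 of_nat_neq_0)
      then show ?thesis
        by (simp add: field_simps del: of_nat_Suc of_nat_add)
    qed
    finally show ?thesis .
  qed
  ultimately show "sinhc_sqrt z + 2 * z * ?d = cosh_sqrt z"
    using cosh_sqrt_sums[of z] sums_unique2 by fastforce
qed

lemma field_differentiable_sqrt_functions:
  fixes z :: "'a::{real_normed_field,banach}"
  shows "cosh_sqrt field_differentiable at z" "sinhc_sqrt field_differentiable at z"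
  using has_field_derivative_cosh_sqrt has_field_derivative_sinhc_sqrt
  unfolding field_differentiable_def by metis+

lemma continuous_on_sqrt_functions [continuous_intros]:
  fixes f :: "'b::topological_space \<Rightarrow> 'a::{real_normed_field,banach}"
  assumes "continuous_on X f"
  shows "continuous_on X (\<lambda>x. cosh_sqrt (f x))" "continuous_on X (\<lambda>x. sinhc_sqrt (f x))"
  by (rule continuous_on_compose2[OF _ assms subset_UNIV],
      intro continuous_at_imp_continuous_on ballI field_differentiable_imp_continuous_at
        field_differentiable_sqrt_functions)+

section \<open>The transfer matrix of one layer\<close>

text \<open>
  The system \<open>u' = - a y\<close>, \<open>y' = b u\<close> has the transfer matrix with rows \<open>(c, - a d)\<close> and \<open>(b d, c)\<close>, where
  \<open>c\<close> and \<open>d\<close> are the two functions below; for \<open>a b > 0\<close> they are \<open>cos (\<kappa> x)\<close> and \<open>sin (\<kappa> x) / \<kappa>\<close> with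
  \<open>\<kappa> = \<surd>(a b)\<close>.
\<close>

definition layer_cos :: "'a::{real_normed_field,banach} \<Rightarrow> 'a \<Rightarrow> 'a \<Rightarrow> 'a" where
  "layer_cos a b x = cosh_sqrt (- (a * b * x\<^sup>2))"

definition layer_sin :: "'a::{real_normed_field,banach} \<Rightarrow> 'a \<Rightarrow> 'a \<Rightarrow> 'a" where
  "layer_sin a b x = x * sinhc_sqrt (- (a * b * x\<^sup>2))"

lemma layer_at_0 [simp]: "layer_cos a b 0 = 1" "layer_sin a b 0 = 0"
  by (simp_all add: layer_cos_def layer_sin_def)

lemma layer_cos_degenerate [simp]: "layer_cos 0 b x = 1" "layer_cos a 0 x = 1"
  by (simp_all add: layer_cos_def)

lemma continuous_on_layer [continuous_intros]:
  fixes f g h :: "'b::topological_space \<Rightarrow> 'a::{real_normed_field,banach}"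
  assumes "continuous_on X f" "continuous_on X g" "continuous_on X h"
  shows "continuous_on X (\<lambda>p. layer_cos (f p) (g p) (h p))"
    and "continuous_on X (\<lambda>p. layer_sin (f p) (g p) (h p))"
  unfolding layer_cos_def layer_sin_def by (intro continuous_intros assms)+

lemma layer_det: "(layer_cos a b x)\<^sup>2 + a * b * (layer_sin a b x)\<^sup>2 = 1"
  for a b x :: real
proof -
  define w where "w = csqrt (of_real (- (a * b * x\<^sup>2)))"
  have w2: "w\<^sup>2 = complex_of_real (- (a * b * x\<^sup>2))"
    by (simp add: w_def)
  have "complex_of_real ((cosh_sqrt (- (a * b * x\<^sup>2)))\<^sup>2 - (- (a * b * x\<^sup>2)) * (sinhc_sqrt (- (a * b * x\<^sup>2)))\<^sup>2)
      = (cosh_sqrt (w\<^sup>2))\<^sup>2 - w\<^sup>2 * (sinhc_sqrt (w\<^sup>2))\<^sup>2"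
    unfolding w2 cosh_sqrt_of_real sinhc_sqrt_of_real by simp
  also have "\<dots> = (cosh w)\<^sup>2 - (w * sinhc_sqrt (w\<^sup>2))\<^sup>2"
    by (simp add: cosh_sqrt_square power_mult_distrib)
  also have "\<dots> = complex_of_real 1"
    by (simp add: sinhc_sqrt_square cosh_square_eq)
  finally have "(cosh_sqrt (- (a * b * x\<^sup>2)))\<^sup>2 - (- (a * b * x\<^sup>2)) * (sinhc_sqrt (- (a * b * x\<^sup>2)))\<^sup>2 = 1"
    unfolding of_real_eq_iff .
  then show ?thesis
    by (simp add: layer_cos_def layer_sin_def power_mult_distrib mult_ac)
qed

lemma layer_has_derivative:
  fixes a b x :: real
  shows "(layer_cos a b has_real_derivative - (a * b * layer_sin a b x)) (at x)"
    and "(layer_sin a b has_real_derivative layer_cos a b x) (at x)"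
proof -
  let ?z = "- (a * b * x\<^sup>2)"
  have inner: "((\<lambda>x. - (a * b * x\<^sup>2)) has_real_derivative - (2 * a * b * x)) (at x)"
    by (auto intro!: derivative_eq_intros)
  show "(layer_cos a b has_real_derivative - (a * b * layer_sin a b x)) (at x)"
    unfolding layer_cos_def[abs_def] layer_sin_def
    by (rule DERIV_cong[OF DERIV_chain2[OF has_field_derivative_cosh_sqrt inner]]) simp
  obtain d where d: "(sinhc_sqrt has_field_derivative d) (at ?z)"
      "sinhc_sqrt ?z + 2 * ?z * d = cosh_sqrt ?z"
    by (rule has_field_derivative_sinhc_sqrt)
  show "(layer_sin a b has_real_derivative layer_cos a b x) (at x)"
    unfolding layer_cos_def layer_sin_def[abs_def] d(2)[symmetric]
    by (rule DERIV_cong[OF DERIV_mult[OF DERIV_ident DERIV_chain2[OF d(1) inner]]])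
      (simp add: power2_eq_square algebra_simps)
qed

lemma layer_oscillating:
  fixes a b :: real
  assumes "0 < a" "0 < b"
  shows "layer_cos a b x = cos (sqrt (a * b) * x)"
    and "layer_sin a b x = sin (sqrt (a * b) * x) / sqrt (a * b)"
proof -
  define \<kappa> where "\<kappa> = sqrt (a * b)"
  have \<kappa>: "\<kappa> > 0" "\<kappa>\<^sup>2 = a * b"
    using assms by (auto simp: \<kappa>_def)
  have z: "complex_of_real (- (a * b * x\<^sup>2)) = (\<i> * of_real (\<kappa> * x))\<^sup>2"
    by (simp add: power_mult_distrib flip: \<kappa>(2))
  have "complex_of_real (layer_cos a b x) = of_real (cos (\<kappa> * x))"
    unfolding layer_cos_def cosh_sqrt_of_real[symmetric] z cosh_sqrt_square
    by (simp add: cosh_conv_cos flip: cos_of_real)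
  then show "layer_cos a b x = cos (sqrt (a * b) * x)"
    unfolding \<kappa>_def by (simp only: of_real_eq_iff)
  have "\<i> * complex_of_real (\<kappa> * layer_sin a b x)
      = (\<i> * of_real (\<kappa> * x)) * sinhc_sqrt ((\<i> * of_real (\<kappa> * x))\<^sup>2)"
    unfolding layer_sin_def z[symmetric] sinhc_sqrt_of_real by simp
  also have "\<dots> = \<i> * of_real (sin (\<kappa> * x))"
    by (simp add: sinhc_sqrt_square sinh_conv_sin flip: sin_of_real)
  finally have "\<kappa> * layer_sin a b x = sin (\<kappa> * x)"
    by (simp only: mult_cancel_left of_real_eq_iff) simp
  then show "layer_sin a b x = sin (sqrt (a * b) * x) / sqrt (a * b)"
    using \<kappa>(1) unfolding \<kappa>_def
    by (metis less_irrefl nonzero_mult_div_cancel_left)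
qed

section \<open>The angle of a vector moved through one layer\<close>

text \<open>
  A function that increases wherever it vanishes can only cross zero upwards. All comparison
  arguments for angles below are instances of this.
\<close>

lemma nonneg_if_derivative_pos_at_zeros:
  fixes D D' :: "real \<Rightarrow> real"
  assumes deriv: "\<And>t. 0 \<le> t \<Longrightarrow> (D has_real_derivative D' t) (at t)"
    and pos: "\<And>t. 0 \<le> t \<Longrightarrow> D t = 0 \<Longrightarrow> 0 < D' t"
    and init: "0 \<le> D 0" and x: "0 \<le> x"
  shows "0 \<le> D x"
proof (rule ccontr)
  assume neg: "\<not> 0 \<le> D x"
  define X where "X = {t \<in> {0..x}. D t \<in> {0..}}"
  have cont: "continuous_on {0..x} D"
    using deriv by (intro DERIV_continuous_on[of _ _ D']) (auto intro: DERIV_subset)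
  have "closed X"
    unfolding X_def using cont by (rule continuous_closed_preimage[unfolded vimage_def Int_def, simplified]) auto
  moreover have X: "X \<noteq> {}" "bdd_above X"
    using init x by (auto simp: X_def intro!: exI[of _ 0])
  ultimately have SX: "Sup X \<in> X"
    by (intro closed_contains_Sup)
  define t where "t = Sup X"
  have t: "0 \<le> t" "t < x" "0 \<le> D t"
    using SX neg unfolding t_def X_def by (auto simp: less_le)
  \<comment> \<open>At the last nonnegative time, \<open>D\<close> stays nonnegative a little longer, by continuity or by the sign of the derivative.\<close>
  have "\<exists>d>0. \<forall>h>0. h < d \<longrightarrow> 0 \<le> D (t + h)"
  proof (cases "D t = 0")
    case True
    then show ?thesis
      using DERIV_pos_inc_right[OF deriv pos] t by fastforce
  next
    case False
    then have "\<forall>\<^sub>F y in at t. 0 < D y"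
      using t DERIV_isCont[OF deriv] by (intro order_tendstoD(1)) (auto simp: isCont_def)
    then obtain d where "d > 0" "\<And>y. y \<noteq> t \<Longrightarrow> dist y t < d \<Longrightarrow> 0 < D y"
      by (auto simp: eventually_at)
    then show ?thesis
      by (intro exI[of _ d]) (auto simp: dist_real_def intro: less_imp_le)
  qed
  then obtain d where d: "d > 0" "\<And>h. 0 < h \<Longrightarrow> h < d \<Longrightarrow> 0 \<le> D (t + h)"
    by blast
  define h where "h = min (d / 2) (x - t)"
  have "0 < h" "h < d" "t + h \<le> x"
    using d(1) t by (auto simp: h_def)
  then have "t + h \<in> X"
    using d(2)[of h] t by (simp add: X_def)
  then have "t + h \<le> t"
    unfolding t_def by (rule cSup_upper) (fact X)
  with \<open>0 < h\<close> show False
    by simp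
qed

text \<open>
  A continuous choice of the polar angle is differentiable, since near a point it differs from its value
  there by an arctangent of a quotient of smooth functions.
\<close>

lemma angle_has_real_derivative:
  fixes u y \<theta> :: "real \<Rightarrow> real"
  assumes u: "(u has_real_derivative u') (at x0)" and y: "(y has_real_derivative y') (at x0)"
    and cont: "isCont \<theta> x0"
    and polar: "\<And>x. \<exists>r>0. u x = r * cos (\<theta> x) \<and> y x = r * sin (\<theta> x)"
  shows "(\<theta> has_real_derivative (u x0 * y' - y x0 * u') / ((u x0)\<^sup>2 + (y x0)\<^sup>2)) (at x0)"
proof -
  define N where "N x = u x0 * y x - y x0 * u x" for x
  define M where "M x = u x0 * u x + y x0 * y x" for x
  obtain r0 where r0: "r0 > 0" "u x0 = r0 * cos (\<theta> x0)" "y x0 = r0 * sin (\<theta> x0)"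
    using polar by blast
  have M0: "M x0 = (u x0)\<^sup>2 + (y x0)\<^sup>2" "M x0 > 0" and N0: "N x0 = 0"
  proof -
    have "M x0 = r0\<^sup>2 * ((cos (\<theta> x0))\<^sup>2 + (sin (\<theta> x0))\<^sup>2)"
      unfolding M_def r0 by algebra
    then show "M x0 > 0"
      using r0(1) by simp
  qed (auto simp: M_def N_def power2_eq_square)
  have "\<forall>\<^sub>F x in at x0. dist (\<theta> x) (\<theta> x0) < pi / 2"
    using cont unfolding isCont_def by (rule tendstoD) simp
  then have near: "\<forall>\<^sub>F x in nhds x0. dist (\<theta> x) (\<theta> x0) < pi / 2"
    by (auto simp: eventually_nhds_conv_at)
  have "\<forall>\<^sub>F x in nhds x0. \<theta> x = \<theta> x0 + arctan (N x / M x)"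
    using near
  proof eventually_elim
    case (elim x)
    obtain r where r: "r > 0" "u x = r * cos (\<theta> x)" "y x = r * sin (\<theta> x)"
      using polar by blast
    have "N x = r0 * r * sin (\<theta> x - \<theta> x0)" "M x = r0 * r * cos (\<theta> x - \<theta> x0)"
      unfolding N_def M_def r r0 sin_diff cos_diff by (simp_all add: algebra_simps)
    then have "N x / M x = tan (\<theta> x - \<theta> x0)"
      using r(1) r0(1) by (simp add: tan_def)
    moreover have "arctan (tan (\<theta> x - \<theta> x0)) = \<theta> x - \<theta> x0"
      using elim unfolding dist_real_def by (intro arctan_tan) linarith+
    ultimately show ?case
      by simp
  qed
  moreover have "((\<lambda>x. \<theta> x0 + arctan (N x / M x)) has_real_derivative
      (u x0 * y' - y x0 * u') / ((u x0)\<^sup>2 + (y x0)\<^sup>2)) (at x0)"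
  proof -
    have "(N has_real_derivative (u x0 * y' - y x0 * u')) (at x0)"
      unfolding N_def by (auto intro!: derivative_eq_intros u y)
    moreover have "(M has_real_derivative (u x0 * u' + y x0 * y')) (at x0)"
      unfolding M_def by (auto intro!: derivative_eq_intros u y)
    ultimately have "((\<lambda>x. N x / M x) has_real_derivative (u x0 * y' - y x0 * u') / M x0) (at x0)"
      using M0 N0 by (auto intro!: derivative_eq_intros)
    then have "((\<lambda>x. arctan (N x / M x)) has_real_derivative (u x0 * y' - y x0 * u') / M x0) (at x0)"
      by (rule DERIV_cong[OF DERIV_chain2[OF DERIV_arctan]]) (simp add: N0)
    then show ?thesis
      using DERIV_add[OF DERIV_const] unfolding M0(1) by fastforce
  qed
  ultimately show ?thesis
    by (subst DERIV_cong_ev[OF refl _ refl])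
qed

text \<open>
  The image under the transfer matrix of the unit vector at angle \<open>\<phi>\<close> never vanishes, as the determinant is
  one, and the parameter space is contractible; so the angle of the image can be chosen continuously in
  all four parameters at once. It counts full turns, which the direction alone does not.
\<close>

lemma layer_angle_exists:
  "\<exists>\<Delta> :: real \<Rightarrow> real \<Rightarrow> real \<Rightarrow> real \<Rightarrow> real.
    continuous_on UNIV (\<lambda>(x, a, b, \<phi>). \<Delta> x a b \<phi>) \<and>
    (\<forall>a b \<phi>. \<Delta> 0 a b \<phi> = \<phi>) \<and>
    (\<forall>x a b \<phi>. \<exists>r>0.
      layer_cos a b x * cos \<phi> - a * layer_sin a b x * sin \<phi> = r * cos (\<Delta> x a b \<phi>) \<and>
      b * layer_sin a b x * cos \<phi> + layer_cos a b x * sin \<phi> = r * sin (\<Delta> x a b \<phi>))"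
proof -
  define u where "u x a b \<phi> = layer_cos a b x * cos \<phi> - a * layer_sin a b x * sin \<phi>" for x a b \<phi> :: real
  define y where "y x a b \<phi> = b * layer_sin a b x * cos \<phi> + layer_cos a b x * sin \<phi>" for x a b \<phi> :: real
  \<comment> \<open>Rotating back by \<open>\<phi>\<close> makes \<open>h\<close> equal to one at \<open>x = 0\<close>, where the logarithm is then normalised.\<close>
  define h where "h = (\<lambda>(x, a, b, \<phi>). Complex (u x a b \<phi>) (y x a b \<phi>) * cis (- \<phi>))"
  have "continuous_on UNIV h"
    unfolding h_def u_def y_def case_prod_beta' Complex_eq cis_conv_exp
    by (intro continuous_intros)
  moreover have "h p \<noteq> 0" for p
  proof -
    obtain x a b \<phi> where p: "p = (x, a, b, \<phi>)"
      by (cases p)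
    have "layer_cos a b x * u x a b \<phi> + a * layer_sin a b x * y x a b \<phi> = cos \<phi> * ((layer_cos a b x)\<^sup>2 + a * b * (layer_sin a b x)\<^sup>2)"
      "layer_cos a b x * y x a b \<phi> - b * layer_sin a b x * u x a b \<phi> = sin \<phi> * ((layer_cos a b x)\<^sup>2 + a * b * (layer_sin a b x)\<^sup>2)"
      unfolding u_def y_def by algebra+
    then have "u x a b \<phi> \<noteq> 0 \<or> y x a b \<phi> \<noteq> 0"
      using sin_zero_abs_cos_one[of \<phi>] unfolding layer_det by auto
    then show ?thesis
      by (auto simp: p h_def Complex_eq_0)
  qed
  ultimately obtain g where g: "continuous_on UNIV g" "\<And>p. h p = exp (g p)"
    using continuous_logarithm_on_contractible[of UNIV h]
    by (metis UNIV_I convex_UNIV convex_imp_contractible)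
  define \<Delta> where "\<Delta> x a b \<phi> = \<phi> + Im (g (x, a, b, \<phi>)) - Im (g (0, a, b, \<phi>))" for x a b \<phi>
  have "continuous_on UNIV (\<lambda>(x, a, b, \<phi>). \<Delta> x a b \<phi>)"
    unfolding \<Delta>_def case_prod_beta'
    by (intro continuous_intros continuous_on_compose2[OF g(1)] subset_UNIV)
  moreover have "\<Delta> 0 a b \<phi> = \<phi>" for a b \<phi>
    by (simp add: \<Delta>_def)
  moreover have "\<exists>r>0. u x a b \<phi> = r * cos (\<Delta> x a b \<phi>) \<and> y x a b \<phi> = r * sin (\<Delta> x a b \<phi>)" for x a b \<phi>
  proof (intro exI conjI)
    let ?r = "exp (Re (g (x, a, b, \<phi>)))"
    have "h (0, a, b, \<phi>) = 1"
      by (simp add: h_def u_def y_def cis_mult complex_eq_iff flip: cis.code)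
    then have g0: "exp (g (0, a, b, \<phi>)) = 1"
      using g(2) by metis
    then have r0: "exp (Re (g (0, a, b, \<phi>))) = 1"
      by (metis norm_exp_eq_Re norm_one)
    then have "cis (Im (g (0, a, b, \<phi>))) = 1"
      using g0 by (simp add: exp_eq_polar)
    have "Complex (u x a b \<phi>) (y x a b \<phi>) = h (x, a, b, \<phi>) * cis \<phi>"
      by (simp add: h_def mult.assoc cis_mult)
    also have "\<dots> = of_real ?r * (cis (Im (g (x, a, b, \<phi>))) * cis \<phi> / cis (Im (g (0, a, b, \<phi>))))"
      using \<open>cis _ = 1\<close> by (simp add: g(2) exp_eq_polar)
    also have "\<dots> = of_real ?r * cis (\<Delta> x a b \<phi>)"
      unfolding \<Delta>_def by (simp add: cis_mult cis_divide add_ac)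
    finally show "u x a b \<phi> = ?r * cos (\<Delta> x a b \<phi>)" "y x a b \<phi> = ?r * sin (\<Delta> x a b \<phi>)"
      by (simp_all add: complex_eq_iff)
  qed auto
  ultimately show ?thesis
    unfolding u_def y_def by blast
qed

definition layer_angle :: "real \<Rightarrow> real \<Rightarrow> real \<Rightarrow> real \<Rightarrow> real" where
  "layer_angle = (SOME \<Delta>.
    continuous_on UNIV (\<lambda>(x, a, b, \<phi>). \<Delta> x a b \<phi>) \<and>
    (\<forall>a b \<phi>. \<Delta> 0 a b \<phi> = \<phi>) \<and>
    (\<forall>x a b \<phi>. \<exists>r>0.
      layer_cos a b x * cos \<phi> - a * layer_sin a b x * sin \<phi> = r * cos (\<Delta> x a b \<phi>) \<and>
      b * layer_sin a b x * cos \<phi> + layer_cos a b x * sin \<phi> = r * sin (\<Delta> x a b \<phi>)))"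

lemma layer_angle_0 [simp]: "layer_angle 0 a b \<phi> = \<phi>"
  and layer_angle_polar: "\<exists>r>0.
      layer_cos a b x * cos \<phi> - a * layer_sin a b x * sin \<phi> = r * cos (layer_angle x a b \<phi>) \<and>
      b * layer_sin a b x * cos \<phi> + layer_cos a b x * sin \<phi> = r * sin (layer_angle x a b \<phi>)"
  and continuous_layer_angle_UNIV: "continuous_on UNIV (\<lambda>(x, a, b, \<phi>). layer_angle x a b \<phi>)"
  using someI_ex[OF layer_angle_exists, folded layer_angle_def] by blast+

lemma continuous_on_layer_angle [continuous_intros]:
  fixes X :: "'b::topological_space set"
  assumes "continuous_on X f" "continuous_on X a" "continuous_on X b" "continuous_on X \<phi>"
  shows "continuous_on X (\<lambda>p. layer_angle (f p) (a p) (b p) (\<phi> p))"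
proof -
  have "continuous_on X (\<lambda>p. (f p, a p, b p, \<phi> p))"
    by (intro continuous_on_Pair assms)
  from continuous_on_compose2[OF continuous_layer_angle_UNIV this] show ?thesis
    by simp
qed

lemma layer_angle_has_derivative:
  "((\<lambda>x. layer_angle x a b \<phi>) has_real_derivative
     a * (sin (layer_angle x a b \<phi>))\<^sup>2 + b * (cos (layer_angle x a b \<phi>))\<^sup>2) (at x)"
proof -
  define u where "u x = layer_cos a b x * cos \<phi> - a * layer_sin a b x * sin \<phi>" for x
  define y where "y x = b * layer_sin a b x * cos \<phi> + layer_cos a b x * sin \<phi>" for x
  let ?\<theta> = "layer_angle x a b \<phi>"
  have "(u has_real_derivative - (a * y x)) (at x)"
    unfolding u_def y_def
    by (auto intro!: derivative_eq_intros layer_has_derivative simp: algebra_simps)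
  moreover have "(y has_real_derivative b * u x) (at x)"
    unfolding u_def y_def
    by (auto intro!: derivative_eq_intros layer_has_derivative simp: algebra_simps)
  moreover have "isCont (\<lambda>x. layer_angle x a b \<phi>) x"
    by (intro continuous_on_interior[where S=UNIV] continuous_intros) auto
  moreover have polar: "\<exists>r>0. u x = r * cos (layer_angle x a b \<phi>) \<and> y x = r * sin (layer_angle x a b \<phi>)" for x
    unfolding u_def y_def by (rule layer_angle_polar)
  ultimately have "((\<lambda>x. layer_angle x a b \<phi>) has_real_derivative
      (u x * (b * u x) - y x * - (a * y x)) / ((u x)\<^sup>2 + (y x)\<^sup>2)) (at x)"
    by (rule angle_has_real_derivative)
  moreover obtain r where r: "r > 0" "u x = r * cos ?\<theta>" "y x = r * sin ?\<theta>"
    using polar by blast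
  have "(u x)\<^sup>2 + (y x)\<^sup>2 = r\<^sup>2 * ((cos ?\<theta>)\<^sup>2 + (sin ?\<theta>)\<^sup>2)"
    unfolding r by algebra
  then have "(u x)\<^sup>2 + (y x)\<^sup>2 = r\<^sup>2"
    by simp
  moreover have "u x * (b * u x) - y x * - (a * y x) = r\<^sup>2 * (a * (sin ?\<theta>)\<^sup>2 + b * (cos ?\<theta>)\<^sup>2)"
    unfolding r by algebra
  ultimately show ?thesis
    using r(1) by simp
qed

text \<open>
  If two such angles with strictly ordered coefficients meet, the one with the larger coefficients has the
  larger slope, as sine and cosine do not vanish together.
\<close>

lemma layer_angle_mono_if_coefficients_less:
  assumes "0 \<le> x" "a < a'" "b < b'" "\<phi> \<le> \<phi>'"
  shows "layer_angle x a b \<phi> \<le> layer_angle x a' b' \<phi>'"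
proof -
  let ?\<alpha> = "\<lambda>t. layer_angle t a b \<phi>" and ?\<beta> = "\<lambda>t. layer_angle t a' b' \<phi>'"
  have "0 \<le> ?\<beta> x - ?\<alpha> x"
  proof (rule nonneg_if_derivative_pos_at_zeros[where D = "\<lambda>t. ?\<beta> t - ?\<alpha> t" and x = x])
    show "((\<lambda>t. ?\<beta> t - ?\<alpha> t) has_real_derivative
        (a' * (sin (?\<beta> t))\<^sup>2 + b' * (cos (?\<beta> t))\<^sup>2) - (a * (sin (?\<alpha> t))\<^sup>2 + b * (cos (?\<alpha> t))\<^sup>2)) (at t)" for t
      by (intro DERIV_diff layer_angle_has_derivative)
    fix t assume "?\<beta> t - ?\<alpha> t = 0"
    then have eq: "?\<beta> t = ?\<alpha> t"
      by simp
    have "(sin (?\<alpha> t))\<^sup>2 > 0 \<or> (cos (?\<alpha> t))\<^sup>2 > 0"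
      using sin_zero_abs_cos_one[of "?\<alpha> t"] by auto
    then have "0 < (a' - a) * (sin (?\<alpha> t))\<^sup>2 + (b' - b) * (cos (?\<alpha> t))\<^sup>2"
      using assms by (auto intro: add_pos_nonneg add_nonneg_pos)
    then show "0 < (a' * (sin (?\<beta> t))\<^sup>2 + b' * (cos (?\<beta> t))\<^sup>2) - (a * (sin (?\<alpha> t))\<^sup>2 + b * (cos (?\<alpha> t))\<^sup>2)"
      unfolding eq by (simp add: algebra_simps)
  qed (use assms in auto)
  then show ?thesis
    by simp
qed

lemma layer_angle_mono:
  assumes "0 \<le> x" "a \<le> a'" "b \<le> b'" "\<phi> \<le> \<phi>'"
  shows "layer_angle x a b \<phi> \<le> layer_angle x a' b' \<phi>'"
proof (rule tendsto_lowerbound)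
  have "continuous_on UNIV (\<lambda>\<epsilon>. layer_angle x (a' + \<epsilon>) (b' + \<epsilon>) \<phi>')"
    by (intro continuous_intros)
  then have "isCont (\<lambda>\<epsilon>. layer_angle x (a' + \<epsilon>) (b' + \<epsilon>) \<phi>') 0"
    by (simp add: continuous_on_eq_continuous_at)
  then have "((\<lambda>\<epsilon>. layer_angle x (a' + \<epsilon>) (b' + \<epsilon>) \<phi>') \<longlongrightarrow> layer_angle x (a' + 0) (b' + 0) \<phi>') (at_right 0)"
    unfolding isCont_def by (rule tendsto_within_subset) simp
  then show "((\<lambda>\<epsilon>. layer_angle x (a' + \<epsilon>) (b' + \<epsilon>) \<phi>') \<longlongrightarrow> layer_angle x a' b' \<phi>') (at_right 0)"
    by simp
  show "\<forall>\<^sub>F \<epsilon> in at_right 0. layer_angle x a b \<phi> \<le> layer_angle x (a' + \<epsilon>) (b' + \<epsilon>) \<phi>'"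
    using eventually_at_right_less by eventually_elim (use assms in \<open>intro layer_angle_mono_if_coefficients_less; simp\<close>)
qed simp

text \<open>
  Where the cosine vanishes, the slope of the angle is \<open>a > 0\<close> whatever \<open>b\<close> is; so the angle crosses these
  directions only upwards.
\<close>

lemma layer_angle_ge_vertical:
  assumes "0 \<le> x" "0 < a" "cos c = 0" "c \<le> \<phi>"
  shows "c \<le> layer_angle x a b \<phi>"
proof -
  have "0 \<le> layer_angle x a b \<phi> - c"
  proof (rule nonneg_if_derivative_pos_at_zeros[where D = "\<lambda>t. layer_angle t a b \<phi> - c" and x = x])
    show "((\<lambda>t. layer_angle t a b \<phi> - c) has_real_derivative
      a * (sin (layer_angle t a b \<phi>))\<^sup>2 + b * (cos (layer_angle t a b \<phi>))\<^sup>2) (at t)" for t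
      using DERIV_diff[OF layer_angle_has_derivative DERIV_const] by simp
    fix t assume "layer_angle t a b \<phi> - c = 0"
    then have "layer_angle t a b \<phi> = c"
      by simp
    moreover have "(sin c)\<^sup>2 = 1"
      using assms(3) by (simp add: sin_squared_eq)
    ultimately show "0 < a * (sin (layer_angle t a b \<phi>))\<^sup>2 + b * (cos (layer_angle t a b \<phi>))\<^sup>2"
      using assms by simp
  qed (use assms in auto)
  then show ?thesis
    by simp
qed

text \<open>
  The vertical directions are \<open>\<pi>\<close> apart, so there is one in every interval of that length below \<open>\<phi>\<close>.
\<close>

lemma layer_angle_ge_minus_pi:
  assumes "0 \<le> x" "0 < a"
  shows "\<phi> - pi \<le> layer_angle x a b \<phi>"
proof -
  \<comment> \<open>\<open>c\<close> is the largest zero of the cosine that does not exceed \<open>\<phi>\<close>.\<close>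
  define k where "k = \<lfloor>\<phi> / pi - 1 / 2\<rfloor>"
  define c where "c = pi / 2 + of_int k * pi"
  have "cos c = 0"
    unfolding c_def cos_add by (simp add: sin_zero_iff_int2)
  moreover have "c \<le> \<phi>" "\<phi> - pi \<le> c"
  proof -
    have "of_int k \<le> \<phi> / pi - 1 / 2" "\<phi> / pi - 1 / 2 < of_int k + 1"
      unfolding k_def by linarith+
    then show "c \<le> \<phi>" "\<phi> - pi \<le> c"
      unfolding c_def by (auto simp: field_simps)
  qed
  ultimately show ?thesis
    using layer_angle_ge_vertical[OF assms, of c \<phi> b] by linarith
qed

text \<open>
  For \<open>b = 0\<close> the vector \<open>(1, 0)\<close> is stationary, and smaller \<open>b\<close> and \<open>\<phi>\<close> give a smaller angle.
\<close>

lemma layer_angle_nonpos: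
  assumes "0 \<le> x" "b \<le> 0" "\<phi> \<le> 0"
  shows "layer_angle x a b \<phi> \<le> 0"
proof -
  have sin0: "sin (layer_angle t a 0 0) = 0" for t
    using layer_angle_polar[of a 0 t 0] by auto
  have "((\<lambda>t. layer_angle t a 0 0) has_real_derivative 0) (at t)" for t
    using layer_angle_has_derivative[of a 0 0 t] by (simp add: sin0)
  then have "layer_angle x a 0 0 = layer_angle 0 a 0 0"
    by (intro DERIV_isconst_all) blast
  then show ?thesis
    using layer_angle_mono[OF assms(1) order_refl assms(2,3), of a] by simp
qed

text \<open>
  For \<open>a = 0\<close> the first component is constant, so the vector stays in the open right half-plane.
\<close>

lemma layer_angle_acute:
  assumes "\<phi> \<in> {- pi / 2 <..< pi / 2}"
  shows "layer_angle x 0 b \<phi> \<in> {- pi / 2 <..< pi / 2}"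
proof -
  let ?I = "range (\<lambda>t. layer_angle t 0 b \<phi>)"
  have "0 < cos \<phi>"
    using assms by (intro cos_gt_zero_pi) auto
  have "cos (layer_angle t 0 b \<phi>) \<noteq> 0" for t
    using layer_angle_polar[of 0 b t \<phi>] \<open>0 < cos \<phi>\<close> by auto
  then have ne: "cos \<theta> \<noteq> 0" if "\<theta> \<in> ?I" for \<theta>
    using that by auto
  have "connected ?I"
    by (intro connected_continuous_image continuous_intros) auto
  then have between: "\<theta> \<in> ?I" if "\<theta> \<in> {p..q}" "p \<in> ?I" "q \<in> ?I" for \<theta> p q
    using that connected_contains_Icc by blast
  have \<phi>: "\<phi> \<in> ?I"
    by (metis layer_angle_0 rangeI)
  have "- pi / 2 \<notin> ?I" "pi / 2 \<notin> ?I"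
    using ne[of "- pi / 2"] ne[of "pi / 2"] by auto
  then show ?thesis
    using between[of "pi / 2" \<phi> "layer_angle x 0 b \<phi>"] between[of "- pi / 2" "layer_angle x 0 b \<phi>" \<phi>] assms \<phi>
    by fastforce
qed

text \<open>
  In an oscillating layer the transfer matrix over the distance \<open>\<pi> / \<surd>(a b)\<close> is minus the identity. The angle
  therefore changes by a multiple of \<open>\<pi>\<close> over each such distance, and by at least \<open>\<pi>\<close> since it is strictly
  increasing.
\<close>

lemma layer_angle_rotates:
  assumes "0 < a" "0 < b" and x: "of_nat k * pi \<le> sqrt (a * b) * x"
  shows "\<phi> + of_nat k * pi \<le> layer_angle x a b \<phi>"
proof -
  let ?\<kappa> = "sqrt (a * b)"
  have \<kappa>: "?\<kappa> > 0"
    using assms by simp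
  have strict: "layer_angle s a b \<phi> < layer_angle t a b \<phi>" if "s < t" for s t
  proof (rule DERIV_pos_imp_increasing[OF that])
    fix z
    let ?\<theta> = "layer_angle z a b \<phi>"
    have "(sin ?\<theta>)\<^sup>2 > 0 \<or> (cos ?\<theta>)\<^sup>2 > 0"
      using sin_zero_abs_cos_one[of ?\<theta>] by auto
    then have "0 < a * (sin ?\<theta>)\<^sup>2 + b * (cos ?\<theta>)\<^sup>2"
      using assms by (auto intro: add_pos_nonneg add_nonneg_pos)
    then show "\<exists>d. ((\<lambda>x. layer_angle x a b \<phi>) has_real_derivative d) (at z) \<and> 0 < d"
      using layer_angle_has_derivative by blast
  qed
  have quantized: "\<exists>j::int. layer_angle (of_nat i * pi / ?\<kappa>) a b \<phi> - \<phi> = of_int j * pi" for i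
  proof -
    let ?\<theta> = "layer_angle (of_nat i * pi / ?\<kappa>) a b \<phi>"
    have arg: "?\<kappa> * (of_nat i * pi / ?\<kappa>) = of_nat i * pi"
      using \<kappa> by (metis less_irrefl nonzero_mult_div_cancel_left times_divide_eq_right)
    obtain r where r: "r > 0" "cos (of_nat i * pi) * cos \<phi> = r * cos ?\<theta>" "cos (of_nat i * pi) * sin \<phi> = r * sin ?\<theta>"
      using layer_angle_polar[of a b "of_nat i * pi / ?\<kappa>" \<phi>] \<kappa>
      unfolding layer_oscillating[OF assms(1,2)] arg by auto
    have "r * sin (?\<theta> - \<phi>) = (r * sin ?\<theta>) * cos \<phi> - (r * cos ?\<theta>) * sin \<phi>"
      by (simp add: sin_diff algebra_simps)
    also have "\<dots> = 0"
      unfolding r(2,3)[symmetric] by simp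
    finally show ?thesis
      using r(1) by (simp add: sin_zero_iff_int2)
  qed
  have "\<phi> + of_nat k * pi \<le> layer_angle (of_nat k * pi / ?\<kappa>) a b \<phi>"
  proof (induction k)
    case (Suc k)
    obtain i j where i: "layer_angle (of_nat k * pi / ?\<kappa>) a b \<phi> - \<phi> = of_int i * pi"
      and j: "layer_angle (of_nat (Suc k) * pi / ?\<kappa>) a b \<phi> - \<phi> = of_int j * pi"
      using quantized by metis
    have "of_nat k * pi / ?\<kappa> < of_nat (Suc k) * pi / ?\<kappa>"
      using \<kappa> by (intro divide_strict_right_mono) auto
    from strict[OF this] have "of_int i * pi < of_int j * pi"
      using i j by linarith
    then have "of_int i + 1 \<le> (of_int j :: real)"
      by (metis of_int_1 of_int_add of_int_le_iff of_int_less_iff pi_gt_zero mult_less_cancel_right_pos zless_imp_add1_zle)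
    then have "of_int i * pi + pi \<le> of_int j * pi"
      using mult_right_mono[of "of_int i + 1" "of_int j" pi] by (simp add: algebra_simps)
    moreover have "of_nat (Suc k) * pi = of_nat k * pi + pi"
      by (simp add: algebra_simps)
    ultimately show ?case
      using Suc.IH i j by linarith
  qed simp
  also have "\<dots> \<le> layer_angle x a b \<phi>"
  proof -
    have "of_nat k * pi / ?\<kappa> \<le> x"
      using x \<kappa> by (simp add: field_simps)
    then show ?thesis
      using strict[of "of_nat k * pi / ?\<kappa>" x] by fastforce
  qed
  finally show ?thesis .
qed

section \<open>The angle at the base of the layers\<close>

text \<open>
  The vector \<open>(u, y)\<close> below \<open>m\<close> layers, for frequency \<open>w\<close> and slowness \<open>s\<close>; \<open>p j\<close> is the slowness of layer
  \<open>j\<close>. In the notation of transfer matrices, \<open>u = P\<^sub>m\<close> and, for \<open>w \<noteq> 0\<close>, \<open>y = - Q\<^sub>m / w\<^sup>2\<close>; the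
  recursion also makes sense at \<open>w = 0\<close>, where it describes the limit of small frequencies.
\<close>

fun wave_state ::
  "(nat \<Rightarrow> real) \<Rightarrow> (nat \<Rightarrow> real) \<Rightarrow> (nat \<Rightarrow> real) \<Rightarrow> 'a \<Rightarrow> 'a \<Rightarrow> nat \<Rightarrow>
    'a \<times> 'a::{real_normed_field,banach}" where
  "wave_state T mu p w s 0 = (1, 0)"
| "wave_state T mu p w s (Suc m) =
    (let a = w\<^sup>2 / of_real (mu (Suc m));
         b = of_real (mu (Suc m)) * ((of_real (p (Suc m)))\<^sup>2 - s\<^sup>2);
         c = layer_cos a b (of_real (T (Suc m)));
         d = layer_sin a b (of_real (T (Suc m)));
         (u, y) = wave_state T mu p w s m
     in (c * u - a * d * y, b * d * u + c * y))"

fun pruefer_angle ::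
  "(nat \<Rightarrow> real) \<Rightarrow> (nat \<Rightarrow> real) \<Rightarrow> (nat \<Rightarrow> real) \<Rightarrow> real \<Rightarrow> real \<Rightarrow> nat \<Rightarrow> real" where
  "pruefer_angle T mu p w s 0 = 0"
| "pruefer_angle T mu p w s (Suc m) =
    layer_angle (T (Suc m)) (w\<^sup>2 / mu (Suc m)) (mu (Suc m) * ((p (Suc m))\<^sup>2 - s\<^sup>2))
      (pruefer_angle T mu p w s m)"

lemma wave_state_polar:
  "\<exists>r>0. wave_state T mu p w s m
    = (r * cos (pruefer_angle T mu p w s m), r * sin (pruefer_angle T mu p w s m))"
proof (induction m)
  case 0
  show ?case
    by (intro exI[of _ 1]) simp
next
  case (Suc m)
  let ?a = "w\<^sup>2 / mu (Suc m)" and ?b = "mu (Suc m) * ((p (Suc m))\<^sup>2 - s\<^sup>2)"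
  let ?\<phi> = "pruefer_angle T mu p w s m" and ?\<theta> = "pruefer_angle T mu p w s (Suc m)"
  let ?c = "layer_cos ?a ?b (T (Suc m))" and ?d = "layer_sin ?a ?b (T (Suc m))"
  obtain r where r: "r > 0" "wave_state T mu p w s m = (r * cos ?\<phi>, r * sin ?\<phi>)"
    using Suc.IH by blast
  obtain r' where r': "r' > 0" "?c * cos ?\<phi> - ?a * ?d * sin ?\<phi> = r' * cos ?\<theta>"
      "?b * ?d * cos ?\<phi> + ?c * sin ?\<phi> = r' * sin ?\<theta>"
    using layer_angle_polar[of ?a ?b "T (Suc m)" ?\<phi>] by auto
  have "wave_state T mu p w s (Suc m)
      = (r * (?c * cos ?\<phi> - ?a * ?d * sin ?\<phi>), r * (?b * ?d * cos ?\<phi> + ?c * sin ?\<phi>))"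
    by (simp add: r Let_def algebra_simps)
  also have "\<dots> = (r * r' * cos ?\<theta>, r * r' * sin ?\<theta>)"
    unfolding r' by (simp add: mult.assoc)
  finally show ?case
    using r(1) r'(1) by (metis mult_pos_pos)
qed

lemma continuous_on_pruefer_angle [continuous_intros]:
  fixes X :: "'b::topological_space set"
  assumes "continuous_on X f" "continuous_on X g"
  shows "continuous_on X (\<lambda>x. pruefer_angle T mu p (f x) (g x) m)"
proof (induction m)
  case (Suc m)
  have "continuous_on X (\<lambda>x. (f x)\<^sup>2 / mu (Suc m))"
    using continuous_on_mult_right[OF continuous_on_power[OF assms(1), of 2], of "inverse (mu (Suc m))"]
    by (simp add: divide_inverse)
  then show ?case
    by (auto intro!: continuous_intros Suc.IH assms)
qed simp

text \<open>
  Layers \<open>1, \<dots>, n\<close> rest on the half-space \<open>n + 1\<close>, and \<open>q\<close> is the largest slowness. It is attained in one of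
  the layers of finite thickness, because the half-space is strictly faster than the slowest material.
\<close>

locale layered_medium =
  fixes n :: nat and T mu p :: "nat \<Rightarrow> real" and q :: real
  assumes T_pos: "\<And>j. j \<in> {1..n} \<Longrightarrow> 0 < T j"
    and mu_pos: "\<And>j. j \<in> {1..n+1} \<Longrightarrow> 0 < mu j"
    and p_pos: "\<And>j. j \<in> {1..n+1} \<Longrightarrow> 0 < p j"
    and p_le_q: "\<And>j. j \<in> {1..n+1} \<Longrightarrow> p j \<le> q"
    and q_attained: "\<exists>j\<in>{1..n}. p j = q"
    and p_less_q: "p (n + 1) < q"
begin

abbreviation p_inf where "p_inf \<equiv> p (n + 1)"
abbreviation mu_inf where "mu_inf \<equiv> mu (n + 1)"

abbreviation \<psi> where "\<psi> \<equiv> pruefer_angle T mu p"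

lemma half_space_pos: "0 < p_inf" "0 < mu_inf" "0 < q"
  using p_pos[of "n + 1"] mu_pos[of "n + 1"] p_less_q by auto

lemma pruefer_angle_mono:
  assumes "m \<le> n" "0 \<le> w" "w \<le> w'" "0 \<le> s'" "s' \<le> s"
  shows "\<psi> w s m \<le> \<psi> w' s' m"
  using assms(1)
proof (induction m)
  case (Suc m)
  have "0 < mu (Suc m)" "0 < T (Suc m)"
    using Suc.prems mu_pos T_pos by auto
  then show ?case
    using Suc assms
    by (auto intro!: layer_angle_mono divide_right_mono mult_left_mono power_mono)
qed simp

lemma pruefer_angle_drop:
  assumes "0 < w" "i \<le> m" "m \<le> n"
  shows "\<psi> w s i - of_nat (m - i) * pi \<le> \<psi> w s m"
  using assms(2,3)
proof (induction m rule: dec_induct)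
  case (step m)
  have "0 < mu (Suc m)" "0 < T (Suc m)"
    using step mu_pos T_pos by auto
  then have "\<psi> w s m - pi \<le> \<psi> w s (Suc m)"
    using assms(1) by (simp add: layer_angle_ge_minus_pi)
  moreover have "of_nat (Suc m - i) * pi = of_nat (m - i) * pi + pi"
    using step by (simp add: Suc_diff_le algebra_simps)
  ultimately show ?case
    using step by simp
qed simp

lemma pruefer_angle_ge:
  assumes "0 < w" "m \<le> n"
  shows "- (pi / 2) \<le> \<psi> w s m"
  using assms(2)
proof (induction m)
  case (Suc m)
  have "0 < mu (Suc m)" "0 < T (Suc m)"
    using Suc mu_pos T_pos by auto
  then show ?case
    using Suc assms(1) by (auto intro!: layer_angle_ge_vertical)
qed simp

lemma pruefer_angle_nonpos:
  assumes "m \<le> n"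
  shows "\<psi> w q m \<le> 0"
  using assms
proof (induction m)
  case (Suc m)
  have "0 < mu (Suc m)" "0 < T (Suc m)" "0 < p (Suc m)" "p (Suc m) \<le> q"
    using Suc mu_pos T_pos p_pos p_le_q by auto
  then show ?case
    using Suc by (auto intro!: layer_angle_nonpos mult_nonneg_nonpos power_mono)
qed simp

lemma pruefer_angle_static: "\<psi> 0 s m \<in> {- pi / 2 <..< pi / 2}"
proof (induction m)
  case (Suc m)
  then show ?case
    using layer_angle_acute by simp
qed simp

text \<open>
  A slowest layer turns the vector by about \<open>w \<surd>(q\<^sup>2 - s\<^sup>2) T\<close>; above it the angle is at least \<open>- \<pi> / 2\<close>,
  and each layer below it gives back at most \<open>\<pi>\<close>.
\<close>

lemma pruefer_angle_unbounded:
  assumes "0 \<le> s" "s < q"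
  shows "\<exists>w>0. N \<le> \<psi> w s n"
proof -
  obtain j where j: "j \<in> {1..n}" "p j = q"
    using q_attained by blast
  then obtain m where m: "j = Suc m"
    by (cases j) auto
  define \<sigma> where "\<sigma> = sqrt (q\<^sup>2 - s\<^sup>2)"
  have \<sigma>: "0 < \<sigma>" "\<sigma>\<^sup>2 = q\<^sup>2 - s\<^sup>2"
    using assms power_strict_mono[of s q 2] by (auto simp: \<sigma>_def)
  have pos: "0 < mu j" "0 < T j"
    using j mu_pos T_pos by auto
  obtain k :: nat where k: "N + pi / 2 + of_nat (n - j) * pi \<le> of_nat k * pi"
    using ex_less_of_nat_mult[OF pi_gt_zero, of "N + pi / 2 + of_nat (n - j) * pi"] by (meson less_imp_le)
  \<comment> \<open>At this frequency layer \<open>j\<close> makes at least \<open>k\<close> half-turns; the summand 1 only ensures \<open>w > 0\<close> if \<open>k = 0\<close>.\<close>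
  define w where "w = (of_nat k * pi + 1) / (\<sigma> * T j)"
  have w: "0 < w"
    using \<sigma> pos by (auto simp: w_def intro!: divide_pos_pos add_nonneg_pos)
  have "sqrt (w\<^sup>2 / mu j * (mu j * (q\<^sup>2 - s\<^sup>2))) = sqrt ((w * \<sigma>)\<^sup>2)"
    using pos by (simp add: \<sigma>(2)[symmetric] power_mult_distrib)
  also have "\<dots> = w * \<sigma>"
    using w \<sigma> by simp
  finally have "sqrt (w\<^sup>2 / mu j * (mu j * (q\<^sup>2 - s\<^sup>2))) * T j = of_nat k * pi + 1"
    using pos \<sigma> by (simp add: w_def)
  then have "\<psi> w s m + of_nat k * pi \<le> layer_angle (T j) (w\<^sup>2 / mu j) (mu j * (q\<^sup>2 - s\<^sup>2)) (\<psi> w s m)"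
    using w pos zero_less_power[OF \<sigma>(1), of 2] \<sigma>(2) by (intro layer_angle_rotates) auto
  also have "\<dots> = \<psi> w s j"
    using j by (simp add: m)
  also have "\<dots> \<le> \<psi> w s n + of_nat (n - j) * pi"
    using pruefer_angle_drop[OF w, of j n s] j by simp
  finally have "N \<le> \<psi> w s n"
    using pruefer_angle_ge[OF w, of m s] j k m by simp
  with w show ?thesis
    by blast
qed

section \<open>The phase and its monotonicity\<close>

text \<open>
  The angle between the state at the base of the layers and the direction that continues into the half-space
  as a decaying wave.
\<close>

definition phase :: "real \<Rightarrow> real \<Rightarrow> real" where
  "phase w s = \<psi> w s n - arctan (mu_inf * sqrt (s\<^sup>2 - p_inf\<^sup>2) / w)"

lemma continuous_on_phase [continuous_intros]:
  fixes X :: "'b::topological_space set"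
  assumes "continuous_on X f" "continuous_on X g" "\<And>x. x \<in> X \<Longrightarrow> f x \<noteq> 0"
  shows "continuous_on X (\<lambda>x. phase (f x) (g x))"
  unfolding phase_def using assms by (auto intro!: continuous_intros)

lemma phase_strict_antimono:
  assumes "0 < w" "p_inf \<le> s" "s < s'"
  shows "phase w s' < phase w s"
proof -
  have "\<psi> w s' n \<le> \<psi> w s n"
    using assms half_space_pos by (intro pruefer_angle_mono) auto
  moreover have "s\<^sup>2 < s'\<^sup>2"
    using assms half_space_pos by (intro power_strict_mono) auto
  then have "mu_inf * sqrt (s\<^sup>2 - p_inf\<^sup>2) / w < mu_inf * sqrt (s'\<^sup>2 - p_inf\<^sup>2) / w"
    using assms half_space_pos by (intro divide_strict_right_mono mult_strict_left_mono) auto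
  ultimately show ?thesis
    unfolding phase_def using arctan_less_iff by (smt (verit))
qed

lemma phase_mono:
  assumes "0 < w" "w \<le> w'" "p_inf \<le> s"
  shows "phase w s \<le> phase w' s"
proof -
  have "\<psi> w s n \<le> \<psi> w' s n"
    using assms half_space_pos by (intro pruefer_angle_mono) auto
  moreover have "p_inf\<^sup>2 \<le> s\<^sup>2"
    using assms half_space_pos by (intro power_mono) auto
  then have "mu_inf * sqrt (s\<^sup>2 - p_inf\<^sup>2) / w' \<le> mu_inf * sqrt (s\<^sup>2 - p_inf\<^sup>2) / w"
    using assms half_space_pos by (intro divide_left_mono mult_nonneg_nonneg) auto
  ultimately show ?thesis
    unfolding phase_def using arctan_le_iff by (smt (verit))
qed

lemma phase_strict_mono:
  assumes "0 < w" "w < w'" "p_inf < s"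
  shows "phase w s < phase w' s"
proof -
  have "\<psi> w s n \<le> \<psi> w' s n"
    using assms half_space_pos by (intro pruefer_angle_mono) auto
  moreover have "p_inf\<^sup>2 < s\<^sup>2"
    using assms half_space_pos by (intro power_strict_mono) auto
  then have "mu_inf * sqrt (s\<^sup>2 - p_inf\<^sup>2) / w' < mu_inf * sqrt (s\<^sup>2 - p_inf\<^sup>2) / w"
    using assms half_space_pos by (intro divide_strict_left_mono mult_pos_pos) auto
  ultimately show ?thesis
    unfolding phase_def using arctan_less_iff by (smt (verit))
qed

text \<open>
  At the largest slowness no layer oscillates. The angle of the state lies in \<open>[- \<pi> / 2, 0]\<close> and that of the
  decaying direction in \<open>(0, \<pi> / 2)\<close>.
\<close>

lemma phase_at_q:
  assumes "0 < w"
  shows "phase w q \<in> {- pi <..< 0}"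
proof -
  have "p_inf\<^sup>2 < q\<^sup>2"
    using p_less_q half_space_pos by (intro power_strict_mono) auto
  then have "0 < arctan (mu_inf * sqrt (q\<^sup>2 - p_inf\<^sup>2) / w)"
    using half_space_pos assms by (simp add: zero_less_arctan_iff)
  then show ?thesis
    using pruefer_angle_nonpos[of n w] pruefer_angle_ge[OF assms, of n q] arctan_ubound
    unfolding phase_def by (smt (verit) greaterThanLessThan_iff order_refl field_sum_of_halves)
qed

lemma phase_unbounded:
  assumes "0 \<le> s" "s < q"
  shows "\<exists>w>0. N < phase w s"
proof -
  obtain w where "0 < w" "N + pi / 2 \<le> \<psi> w s n"
    using pruefer_angle_unbounded[OF assms] by blast
  then show ?thesis
    unfolding phase_def using arctan_ubound by (smt (verit))
qed

text \<open>
  As \<open>w\<close> tends to 0, the decaying direction becomes vertical, while the state tends to one whose angle is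
  strictly smaller than \<open>\<pi> / 2\<close>.
\<close>

lemma phase_negative:
  assumes "p_inf < s"
  shows "\<exists>w>0. phase w s < 0"
proof -
  let ?c = "mu_inf * sqrt (s\<^sup>2 - p_inf\<^sup>2)"
  have "p_inf\<^sup>2 < s\<^sup>2"
    using assms half_space_pos by (intro power_strict_mono) auto
  then have c: "0 < ?c"
    using half_space_pos by simp
  have "continuous_on UNIV (\<lambda>w. \<psi> w s n)"
    by (intro continuous_intros)
  then have "isCont (\<lambda>w. \<psi> w s n) 0"
    by (simp add: continuous_on_eq_continuous_at)
  then have "((\<lambda>w. \<psi> w s n) \<longlongrightarrow> \<psi> 0 s n) (at_right 0)"
    unfolding isCont_def by (rule tendsto_within_subset) simp
  moreover have "((\<lambda>w. arctan (?c / w)) \<longlongrightarrow> pi / 2) (at_right 0)"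
  proof (rule filterlim_compose[OF tendsto_arctan_at_top])
    have "filterlim (\<lambda>w. ?c * inverse w) at_top (at_right 0)"
      by (rule filterlim_tendsto_pos_mult_at_top[OF tendsto_const c filterlim_inverse_at_top_right])
    then show "filterlim (\<lambda>w. ?c / w) at_top (at_right 0)"
      by (simp add: divide_inverse)
  qed
  ultimately have "((\<lambda>w. phase w s) \<longlongrightarrow> \<psi> 0 s n - pi / 2) (at_right 0)"
    unfolding phase_def by (rule tendsto_diff)
  moreover have "\<psi> 0 s n - pi / 2 < 0"
    using pruefer_angle_static[of s n] by simp
  ultimately have "\<forall>\<^sub>F w in at_right 0. phase w s < 0"
    by (rule order_tendstoD)
  then have "\<forall>\<^sub>F w in at_right 0. 0 < w \<and> phase w s < 0"
    using eventually_at_right_less[of 0] by eventually_elim simp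
  then show ?thesis
    using eventually_happens trivial_limit_at_right_real by blast
qed

text \<open>
  The dispersion function at \<open>k = w s\<close>, divided by \<open>w\<close>.
\<close>

definition dispersion_real :: "real \<Rightarrow> real \<Rightarrow> real" where
  "dispersion_real w s =
    mu_inf * sqrt (s\<^sup>2 - p_inf\<^sup>2) * fst (wave_state T mu p w s n) - w * snd (wave_state T mu p w s n)"

text \<open>
  Up to a nonvanishing factor, the dispersion function is the sine of the phase.
\<close>

lemma dispersion_real_eq_0_iff:
  assumes "0 < w"
  shows "dispersion_real w s = 0 \<longleftrightarrow> (\<exists>i::int. phase w s = of_int i * pi)"
proof -
  define t where "t = mu_inf * sqrt (s\<^sup>2 - p_inf\<^sup>2) / w"
  obtain r where r: "r > 0" "wave_state T mu p w s n = (r * cos (\<psi> w s n), r * sin (\<psi> w s n))"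
    using wave_state_polar by blast
  have cos: "cos (arctan t) > 0"
    by (intro cos_gt_zero_pi arctan_lbound arctan_ubound)
  have "sin (arctan t) = t * cos (arctan t)"
    using cos by (metis less_irrefl nonzero_divide_eq_eq tan_arctan tan_def)
  then have "w * r * sin (phase w s) = - (cos (arctan t) * dispersion_real w s)"
    using assms unfolding phase_def dispersion_real_def sin_diff r
    by (simp flip: t_def) (simp add: t_def algebra_simps)
  then have "dispersion_real w s = 0 \<longleftrightarrow> sin (phase w s) = 0"
    using assms r cos by (metis less_irrefl mult_eq_0_iff neg_equal_0_iff_equal)
  then show ?thesis
    by (simp add: sin_zero_iff_int2)
qed

end

section \<open>Holomorphic functions of two variables\<close>

text \<open>
  Continuous differentiability with complex linear derivatives: exactly what the inverse function theorem on
  the real vector space \<open>\<complex>\<^sup>2\<close> asks for and what makes the implicit function holomorphic.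
\<close>

definition holomorphic_on2 :: "(complex \<times> complex \<Rightarrow> complex) \<Rightarrow> (complex \<times> complex) set \<Rightarrow> bool" where
  "holomorphic_on2 F U \<longleftrightarrow> (\<exists>F1 F2. continuous_on U F1 \<and> continuous_on U F2 \<and>
    (\<forall>z\<in>U. (F has_derivative (\<lambda>h. F1 z * fst h + F2 z * snd h)) (at z)))"

lemma holomorphic_on2I:
  assumes "continuous_on U F1" "continuous_on U F2"
    "\<And>z. z \<in> U \<Longrightarrow> (F has_derivative (\<lambda>h. F1 z * fst h + F2 z * snd h)) (at z)"
  shows "holomorphic_on2 F U"
  using assms unfolding holomorphic_on2_def by blast

lemma holomorphic_on2E:
  assumes "holomorphic_on2 F U"
  obtains F1 F2 where "continuous_on U F" "continuous_on U F1" "continuous_on U F2"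
    "\<forall>z\<in>U. (F has_derivative (\<lambda>h. F1 z * fst h + F2 z * snd h)) (at z)"
  using assms unfolding holomorphic_on2_def
  by (meson continuous_at_imp_continuous_on has_derivative_continuous)

lemma holomorphic_on2_const: "holomorphic_on2 (\<lambda>z. c) U"
  by (rule holomorphic_on2I[of _ "\<lambda>z. 0" "\<lambda>z. 0"]) auto

lemma holomorphic_on2_fst: "holomorphic_on2 fst U"
  by (rule holomorphic_on2I[of _ "\<lambda>z. 1" "\<lambda>z. 0"]) (auto intro!: derivative_eq_intros)

lemma holomorphic_on2_snd: "holomorphic_on2 snd U"
  by (rule holomorphic_on2I[of _ "\<lambda>z. 0" "\<lambda>z. 1"]) (auto intro!: derivative_eq_intros)

lemma holomorphic_on2_add:
  assumes "holomorphic_on2 F U" "holomorphic_on2 G U"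
  shows "holomorphic_on2 (\<lambda>z. F z + G z) U"
proof -
  obtain F1 F2 where F: "continuous_on U F" "continuous_on U F1" "continuous_on U F2"
    "\<forall>z\<in>U. (F has_derivative (\<lambda>h. F1 z * fst h + F2 z * snd h)) (at z)"
    using assms(1) by (rule holomorphic_on2E)
  obtain G1 G2 where G: "continuous_on U G" "continuous_on U G1" "continuous_on U G2"
    "\<forall>z\<in>U. (G has_derivative (\<lambda>h. G1 z * fst h + G2 z * snd h)) (at z)"
    using assms(2) by (rule holomorphic_on2E)
  show ?thesis
    by (rule holomorphic_on2I[of _ "\<lambda>z. F1 z + G1 z" "\<lambda>z. F2 z + G2 z"])
      (auto intro!: continuous_intros F(1-3) G(1-3) derivative_eq_intros F(4)[rule_format] G(4)[rule_format] simp: algebra_simps)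
qed

lemma holomorphic_on2_mult:
  assumes "holomorphic_on2 F U" "holomorphic_on2 G U"
  shows "holomorphic_on2 (\<lambda>z. F z * G z) U"
proof -
  obtain F1 F2 where F: "continuous_on U F" "continuous_on U F1" "continuous_on U F2"
    "\<forall>z\<in>U. (F has_derivative (\<lambda>h. F1 z * fst h + F2 z * snd h)) (at z)"
    using assms(1) by (rule holomorphic_on2E)
  obtain G1 G2 where G: "continuous_on U G" "continuous_on U G1" "continuous_on U G2"
    "\<forall>z\<in>U. (G has_derivative (\<lambda>h. G1 z * fst h + G2 z * snd h)) (at z)"
    using assms(2) by (rule holomorphic_on2E)
  show ?thesis
    by (rule holomorphic_on2I[of _ "\<lambda>z. F z * G1 z + F1 z * G z" "\<lambda>z. F z * G2 z + F2 z * G z"])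
      (auto intro!: continuous_intros F(1-3) G(1-3) derivative_eq_intros F(4)[rule_format] G(4)[rule_format] simp: algebra_simps)
qed

lemma holomorphic_on2_minus: "holomorphic_on2 F U \<Longrightarrow> holomorphic_on2 (\<lambda>z. - F z) U"
  using holomorphic_on2_mult[OF holomorphic_on2_const[of "-1"]] by simp

lemma holomorphic_on2_diff:
  "holomorphic_on2 F U \<Longrightarrow> holomorphic_on2 G U \<Longrightarrow> holomorphic_on2 (\<lambda>z. F z - G z) U"
  using holomorphic_on2_add[OF _ holomorphic_on2_minus] by simp

lemma holomorphic_on2_divide_const:
  "holomorphic_on2 F U \<Longrightarrow> holomorphic_on2 (\<lambda>z. F z / c) U"
  using holomorphic_on2_mult[OF _ holomorphic_on2_const[of "inverse c"]]
  by (simp add: divide_inverse)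

lemma holomorphic_on2_power2: "holomorphic_on2 F U \<Longrightarrow> holomorphic_on2 (\<lambda>z. (F z)\<^sup>2) U"
  using holomorphic_on2_mult by (simp add: power2_eq_square)

lemma holomorphic_on2_compose:
  assumes "holomorphic_on2 F U" "g holomorphic_on V" "open V" "F ` U \<subseteq> V"
  shows "holomorphic_on2 (\<lambda>z. g (F z)) U"
proof -
  obtain F1 F2 where F: "continuous_on U F" "continuous_on U F1" "continuous_on U F2"
    "\<forall>z\<in>U. (F has_derivative (\<lambda>h. F1 z * fst h + F2 z * snd h)) (at z)"
    using assms(1) by (rule holomorphic_on2E)
  have "continuous_on V (deriv g)"
    using assms by (intro holomorphic_on_imp_continuous_on holomorphic_deriv)
  then have cont: "continuous_on U (\<lambda>z. deriv g (F z))"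
    using F(1) assms(4) by (rule continuous_on_compose2)
  have deriv: "((\<lambda>z. g (F z)) has_derivative
      (\<lambda>h. deriv g (F z) * F1 z * fst h + deriv g (F z) * F2 z * snd h)) (at z)" if "z \<in> U" for z
  proof -
    have "(g has_field_derivative deriv g (F z)) (at (F z))"
      using that assms by (intro holomorphic_derivI[of g V]) auto
    then have "(g has_derivative (*) (deriv g (F z))) (at (F z))"
      by (simp add: has_field_derivative_def)
    from has_derivative_compose[OF F(4)[rule_format, OF that] this] show ?thesis
      by (simp add: algebra_simps)
  qed
  show ?thesis
    by (rule holomorphic_on2I[OF _ _ deriv]) (auto intro!: continuous_intros cont F(2,3))
qed

lemma holomorphic_on2_entire:
  assumes "holomorphic_on2 F U" "\<And>z. g field_differentiable at z"
  shows "holomorphic_on2 (\<lambda>z. g (F z)) U"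
  using assms by (intro holomorphic_on2_compose[of F U g UNIV])
    (auto simp: holomorphic_on_def intro: field_differentiable_at_within)

lemmas holomorphic_on2_intros =
  holomorphic_on2_const holomorphic_on2_fst holomorphic_on2_snd holomorphic_on2_add
  holomorphic_on2_mult holomorphic_on2_minus holomorphic_on2_diff holomorphic_on2_divide_const
  holomorphic_on2_power2 holomorphic_on2_entire[OF _ field_differentiable_sqrt_functions(1)]
  holomorphic_on2_entire[OF _ field_differentiable_sqrt_functions(2)]

text \<open>
  Near \<open>(w0, s0)\<close> the map \<open>(w, s) \<mapsto> (w, F (w, s))\<close> has a differentiable inverse, and the implicit function is
  \<open>w \<mapsto> snd (inverse (w, 0))\<close>. Its derivative is complex linear because it inverts a complex linear map.
\<close>

lemma holomorphic_implicit_function: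
  assumes F: "holomorphic_on2 F U" and U: "open U" "(w0, s0) \<in> U" and zero: "F (w0, s0) = 0"
    and deriv: "((\<lambda>s. F (w0, s)) has_field_derivative d) (at s0)" and d: "d \<noteq> 0"
  obtains g V N where "open V" "w0 \<in> V" "g holomorphic_on V" "open N" "(w0, s0) \<in> N"
    "\<forall>w s. (w, s) \<in> N \<longrightarrow> F (w, s) = 0 \<longrightarrow> w \<in> V \<and> s = g w"
proof -
  obtain F1 F2 where cont: "continuous_on U F1" "continuous_on U F2"
    and F': "\<forall>z\<in>U. (F has_derivative (\<lambda>h. F1 z * fst h + F2 z * snd h)) (at z)"
    using F by (rule holomorphic_on2E)
  have "((\<lambda>s. F (w0, s)) has_derivative (\<lambda>h. F2 (w0, s0) * h)) (at s0)"
  proof -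
    have "((\<lambda>s. (w0, s)) has_derivative (\<lambda>h. (0, h))) (at s0)"
      by (auto intro!: derivative_eq_intros)
    from has_derivative_compose[OF this F'[rule_format, OF U(2)]] show ?thesis
      by simp
  qed
  then have "((\<lambda>s. F (w0, s)) has_field_derivative F2 (w0, s0)) (at s0)"
    by (simp add: has_field_derivative_def)
  with deriv d have F2: "F2 (w0, s0) \<noteq> 0"
    using DERIV_unique by blast

  define \<Phi> where "\<Phi> z = (fst z, F z)" for z
  \<comment> \<open>\<open>L z\<close> is the derivative of \<open>\<Phi>\<close> at \<open>z\<close>, and \<open>K\<close> below is the inverse of \<open>L (w0, s0)\<close>.\<close>
  define L where "L z h = (fst h, F1 z * fst h + F2 z * snd h)" for z h :: "complex \<times> complex"
  have bl: "bounded_linear (L z)" for z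
    unfolding L_def
    by (intro bounded_linear_Pair bounded_linear_add bounded_linear_fst
        bounded_linear_const_mult bounded_linear_snd)
  have app: "blinfun_apply (Blinfun (L z)) = L z" for z
    by (rule bounded_linear_Blinfun_apply[OF bl])
  define K where "K h = (fst h, (snd h - F1 (w0, s0) * fst h) / F2 (w0, s0))" for h
  have blK: "bounded_linear K"
    unfolding K_def
    by (intro bounded_linear_Pair bounded_linear_sub bounded_linear_fst
        bounded_linear_const_mult bounded_linear_snd bounded_linear_compose[OF bounded_linear_divide])
  have inv: "Blinfun K o\<^sub>L Blinfun (L (w0, s0)) = id_blinfun"
  proof (rule blinfun_eqI)
    fix h
    show "blinfun_apply (Blinfun K o\<^sub>L Blinfun (L (w0, s0))) h = blinfun_apply id_blinfun h"
      using F2 by (simp add: app bounded_linear_Blinfun_apply[OF blK]) (simp add: L_def K_def)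
  qed
  have der: "(\<Phi> has_derivative blinfun_apply (Blinfun (L z))) (at z)" if "z \<in> U" for z
    unfolding app L_def \<Phi>_def
    by (intro has_derivative_Pair F'[rule_format, OF that] has_derivative_fst has_derivative_ident)
  have contL: "continuous_on U (\<lambda>z. Blinfun (L z))"
    by (rule continuous_on_blinfun_componentwise)
      (auto simp: app L_def intro!: continuous_intros cont)
  obtain U' V' G G' where G: "open U'" "U' \<subseteq> U" "(w0, s0) \<in> U'" "open V'" "\<Phi> (w0, s0) \<in> V'"
      "homeomorphism U' V' \<Phi> G" "\<And>y. y \<in> V' \<Longrightarrow> (G has_derivative G' y) (at y)"
      "\<And>y. y \<in> V' \<Longrightarrow> G' y = inv (blinfun_apply (Blinfun (L (G y))))"
      "\<And>y. y \<in> V' \<Longrightarrow> bij (blinfun_apply (Blinfun (L (G y))))"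
    using inverse_function_theorem[OF U(1) der contL U(2) inv] by metis
  define V where "V = (\<lambda>w. (w, 0)) -` V'"
  define g where "g w = snd (G (w, 0))" for w
  show ?thesis
  proof (rule that[of V g U'])
    show "open V"
      unfolding V_def by (intro open_vimage G continuous_intros)
    show "w0 \<in> V"
      using G(5) zero by (simp add: V_def \<Phi>_def)
    show "open U'" "(w0, s0) \<in> U'"
      by fact+
    have "(g has_field_derivative - F1 (G (w, 0)) / F2 (G (w, 0))) (at w)" if "w \<in> V" for w
    proof -
      let ?z = "G (w, 0)"
      have V': "(w, 0) \<in> V'"
        using that by (simp add: V_def)
      have bij: "bij (L ?z)" and G': "G' (w, 0) = inv (L ?z)"
        using G(8,9)[OF V'] by (simp_all add: app)
      \<comment> \<open>The partial derivative is known to be nonzero at \<open>(w0, s0)\<close>; elsewhere this follows from invertibility.\<close>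
      have F2z: "F2 ?z \<noteq> 0"
      proof
        assume "F2 ?z = 0"
        then have "L ?z (0, 1) = L ?z (0, 0)"
          by (simp add: L_def)
        then have "(0, 1) = ((0, 0) :: complex \<times> complex)"
          by (rule injD[OF bij_is_inj[OF bij]])
        then show False
          by simp
      qed
      have "((\<lambda>w. (w, 0)) has_derivative (\<lambda>h. (h, 0))) (at w)"
        by (auto intro!: derivative_eq_intros)
      from has_derivative_snd[OF has_derivative_compose[OF this G(7)[OF V']]]
      have "(g has_derivative (\<lambda>h. snd (inv (L ?z) (h, 0)))) (at w)"
        unfolding g_def G' .
      moreover have "inv (L ?z) (h, 0) = (h, - F1 ?z / F2 ?z * h)" for h
      proof (rule inv_f_eq)
        show "inj (L ?z)"
          using bij by (rule bij_is_inj)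
        show "L ?z (h, - F1 ?z / F2 ?z * h) = (h, 0)"
          using F2z by (simp add: L_def)
      qed
      ultimately have "(g has_derivative (\<lambda>h. - F1 ?z / F2 ?z * h)) (at w)"
        by simp
      then show ?thesis
        by (rule has_derivative_imp_has_field_derivative) simp
    qed
    then show "g holomorphic_on V"
      unfolding holomorphic_on_def field_differentiable_def
      using has_field_derivative_at_within by blast
    show "\<forall>w s. (w, s) \<in> U' \<longrightarrow> F (w, s) = 0 \<longrightarrow> w \<in> V \<and> s = g w"
    proof (intro allI impI)
      fix w s assume ws: "(w, s) \<in> U'" "F (w, s) = 0"
      then have "\<Phi> (w, s) = (w, 0)"
        by (simp add: \<Phi>_def)
      then have "(w, 0) \<in> V'" "G (w, 0) = (w, s)"
        using G(6) ws(1) unfolding homeomorphism_def by force+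
      then show "w \<in> V \<and> s = g w"
        by (simp add: V_def g_def)
    qed
  qed
qed

lemma real_power_series_of_holomorphic:
  assumes "open V" "g holomorphic_on V" "complex_of_real x \<in> V"
    and ev: "\<forall>\<^sub>F y in nhds x. complex_of_real (f y) = g (of_real y)"
  shows "\<exists>r>0. \<exists>a::nat \<Rightarrow> real. \<forall>y. \<bar>y - x\<bar> < r \<longrightarrow> (\<lambda>i. a i * (y - x) ^ i) sums f y"
proof -
  obtain r1 where r1: "r1 > 0" "ball (complex_of_real x) r1 \<subseteq> V"
    using assms(1,3) openE by blast
  obtain r2 where r2: "r2 > 0" "\<And>y. dist y x < r2 \<Longrightarrow> complex_of_real (f y) = g (of_real y)"
    using ev unfolding eventually_nhds_metric by blast
  define c where "c i = (deriv ^^ i) g (of_real x) / fact i" for i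
  have "(\<lambda>i. Re (c i) * (y - x) ^ i) sums f y" if "\<bar>y - x\<bar> < min r1 r2" for y
  proof -
    have "dist (complex_of_real y) (of_real x) = \<bar>y - x\<bar>"
      by (simp add: dist_norm flip: of_real_diff)
    then have "complex_of_real y \<in> ball (of_real x) r1"
      using that by (simp add: dist_commute)
    then have "(\<lambda>i. c i * (of_real y - of_real x) ^ i) sums g (of_real y)"
      unfolding c_def
      by (rule holomorphic_power_series[OF holomorphic_on_subset[OF assms(2) r1(2)]])
    then have "(\<lambda>i. Re (c i * (of_real y - of_real x) ^ i)) sums Re (g (of_real y))"
      by (rule sums_Re)
    moreover have "Re (g (of_real y)) = f y"
      using r2(2)[of y] that by (metis Re_complex_of_real dist_real_def min_less_iff_conj)
    moreover have "Re (c i * (of_real y - of_real x) ^ i) = Re (c i) * (y - x) ^ i" for i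
      by (simp flip: of_real_diff of_real_power)
    ultimately show ?thesis
      by simp
  qed
  then show ?thesis
    using r1(1) r2(1) by (intro exI[of _ "min r1 r2"] conjI exI[of _ "\<lambda>i. Re (c i)"]) auto
qed

section \<open>Regularity of the layered state\<close>

lemma wave_state_of_real:
  "wave_state T mu p (complex_of_real w) (of_real s) m
    = map_prod of_real of_real (wave_state T mu p w s m)"
proof (induction m)
  case (Suc m)
  obtain u y where "wave_state T mu p w s m = (u, y)"
    by (cases "wave_state T mu p w s m")
  moreover have "layer_cos (of_real a) (of_real b) (of_real x) = complex_of_real (layer_cos a b x)"
      "layer_sin (of_real a) (of_real b) (of_real x) = complex_of_real (layer_sin a b x)" for a b x
    by (simp_all add: layer_cos_def layer_sin_def flip: cosh_sqrt_of_real sinhc_sqrt_of_real)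
  ultimately show ?case
    using Suc.IH
    by (simp add: Let_def flip: of_real_power of_real_diff of_real_mult of_real_divide of_real_add)
qed simp

lemma holomorphic_on2_wave_state:
  "holomorphic_on2 (\<lambda>z. fst (wave_state T mu p (fst z) (snd z) m)) U"
  "holomorphic_on2 (\<lambda>z. snd (wave_state T mu p (fst z) (snd z) m)) U"
proof (induction m)
  case (Suc m)
  {
    case 1
    show ?case
      unfolding wave_state.simps Let_def case_prod_beta' fst_conv snd_conv layer_cos_def layer_sin_def
      by (intro holomorphic_on2_intros Suc)
  next
    case 2
    show ?case
      unfolding wave_state.simps Let_def case_prod_beta' fst_conv snd_conv layer_cos_def layer_sin_def
      by (intro holomorphic_on2_intros Suc)
  }
qed (simp_all add: holomorphic_on2_const)

lemma field_differentiable_wave_state: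
  fixes w s :: real
  shows "(\<lambda>s. fst (wave_state T mu p w s m)) field_differentiable at s"
    and "(\<lambda>s. snd (wave_state T mu p w s m)) field_differentiable at s"
proof (induction m)
  case (Suc m)
  have entire: "(\<lambda>s. g (f s)) field_differentiable at s"
    if "\<And>z. g field_differentiable at z" "f field_differentiable at s" for f g :: "real \<Rightarrow> real"
    using field_differentiable_compose[OF that(2,1)] by (simp add: o_def)
  note entires = entire[OF field_differentiable_sqrt_functions(1)] entire[OF field_differentiable_sqrt_functions(2)]
  {
    case 1
    show ?case
      unfolding wave_state.simps Let_def case_prod_beta' fst_conv snd_conv layer_cos_def layer_sin_def
      by (intro field_differentiable_const field_differentiable_ident field_differentiable_minus
          field_differentiable_add field_differentiable_diff field_differentiable_mult
          field_differentiable_power entires Suc)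
  next
    case 2
    show ?case
      unfolding wave_state.simps Let_def case_prod_beta' fst_conv snd_conv layer_cos_def layer_sin_def
      by (intro field_differentiable_const field_differentiable_ident field_differentiable_minus
          field_differentiable_add field_differentiable_diff field_differentiable_mult
          field_differentiable_power entires Suc)
  }
qed auto

section \<open>The branches\<close>

lemma nth_rev_sorted_list_of_set_image:
  fixes f :: "nat \<Rightarrow> 'a::linorder"
  assumes "\<And>i j. i < j \<Longrightarrow> j \<le> M \<Longrightarrow> f j < f i" and "m \<le> M"
  shows "rev (sorted_list_of_set (f ` {..M})) ! m = f m"
proof -
  let ?xs = "map f [0..<Suc M]"
  have "sorted_wrt (\<lambda>x y. y < x) ?xs"
    using assms(1) by (auto simp: sorted_wrt_map sorted_wrt_iff_nth_less simp del: upt_Suc)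
  then have strict: "sorted_wrt (<) (rev ?xs)"
    by (simp only: sorted_wrt_rev)
  have "set (rev ?xs) = f ` {..M}"
    by (auto simp del: upt_Suc)
  moreover have "sorted_list_of_set (set (rev ?xs)) = rev ?xs"
    using strict strict_sorted_iff[of "rev ?xs"] by (intro sorted_list_of_set.idem_if_sorted_distinct) auto
  ultimately have "sorted_list_of_set (f ` {..M}) = rev ?xs"
    by (simp only:)
  then show ?thesis
    using assms(2) by (simp del: upt_Suc add: less_Suc_eq_le)
qed

context layered_medium
begin

definition dispersion_complex :: "complex \<times> complex \<Rightarrow> complex" where
  "dispersion_complex z =
    of_real mu_inf * csqrt ((snd z)\<^sup>2 - of_real (p_inf\<^sup>2)) * fst (wave_state T mu p (fst z) (snd z) n)
      - fst z * snd (wave_state T mu p (fst z) (snd z) n)"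

lemma holomorphic_dispersion_complex:
  "holomorphic_on2 dispersion_complex {z. (snd z)\<^sup>2 - of_real (p_inf\<^sup>2) \<notin> \<real>\<^sub>\<le>\<^sub>0}"
  unfolding dispersion_complex_def[abs_def]
proof (intro holomorphic_on2_diff holomorphic_on2_mult holomorphic_on2_wave_state
    holomorphic_on2_const holomorphic_on2_fst)
  show "holomorphic_on2 (\<lambda>z. csqrt ((snd z)\<^sup>2 - complex_of_real (p_inf\<^sup>2)))
      {z. (snd z)\<^sup>2 - of_real (p_inf\<^sup>2) \<notin> \<real>\<^sub>\<le>\<^sub>0}"
  proof (rule holomorphic_on2_compose[OF _ holomorphic_on_csqrt])
    show "holomorphic_on2 (\<lambda>z. (snd z)\<^sup>2 - complex_of_real (p_inf\<^sup>2))
        {z. (snd z)\<^sup>2 - of_real (p_inf\<^sup>2) \<notin> \<real>\<^sub>\<le>\<^sub>0}"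
      by (intro holomorphic_on2_diff holomorphic_on2_power2 holomorphic_on2_snd holomorphic_on2_const)
  qed auto
qed

lemma dispersion_complex_of_real:
  assumes "p_inf \<le> s"
  shows "dispersion_complex (of_real w, of_real s) = of_real (dispersion_real w s)"
proof -
  have "p_inf\<^sup>2 \<le> s\<^sup>2"
    using assms half_space_pos by (intro power_mono) auto
  then have "csqrt ((complex_of_real s)\<^sup>2 - of_real (p_inf\<^sup>2)) = of_real (sqrt (s\<^sup>2 - p_inf\<^sup>2))"
    using csqrt_of_real[of "s\<^sup>2 - p_inf\<^sup>2"] by simp
  then show ?thesis
    by (simp add: dispersion_complex_def dispersion_real_def wave_state_of_real)
qed

text \<open>
  At a root, \<open>u\<close> times the derivative is the sum of a positive term, from the square root, and of \<open>w\<close> times the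
  Wronskian \<open>y u' - u y'\<close>. The Wronskian is the numerator of minus the derivative of the angle, which is
  nonnegative since the angle decreases in \<open>s\<close>.
\<close>

lemma dispersion_real_simple_root:
  assumes w: "0 < w" and s: "p_inf < s" and zero: "dispersion_real w s = 0"
  obtains d where "(dispersion_real w has_real_derivative d) (at s)" "d \<noteq> 0"
proof -
  define u where "u s = fst (wave_state T mu p w s n)" for s
  define y where "y s = snd (wave_state T mu p w s n)" for s
  define \<sigma> where "\<sigma> s = sqrt (s\<^sup>2 - p_inf\<^sup>2)" for s
  have disp: "dispersion_real w s = mu_inf * \<sigma> s * u s - w * y s" for s
    by (simp add: dispersion_real_def u_def y_def \<sigma>_def)
  obtain u' y' where u': "(u has_real_derivative u') (at s)" and y': "(y has_real_derivative y') (at s)"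
    using field_differentiable_wave_state[of T mu p w n s] unfolding field_differentiable_def u_def y_def by blast
  have polar: "\<exists>r>0. u s = r * cos (\<psi> w s n) \<and> y s = r * sin (\<psi> w s n)" for s
    using wave_state_polar[of T mu p w s n] unfolding u_def y_def by auto
  have nonzero: "0 < (u s)\<^sup>2 + (y s)\<^sup>2"
  proof -
    obtain r where r: "r > 0" "u s = r * cos (\<psi> w s n)" "y s = r * sin (\<psi> w s n)"
      using polar by blast
    have "(u s)\<^sup>2 + (y s)\<^sup>2 = r\<^sup>2 * ((cos (\<psi> w s n))\<^sup>2 + (sin (\<psi> w s n))\<^sup>2)"
      unfolding r by algebra
    then show ?thesis
      using r(1) by simp
  qed
  have "isCont (\<lambda>s. \<psi> w s n) s"
    by (intro continuous_on_interior[where S = UNIV] continuous_intros) auto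
  then have "((\<lambda>s. \<psi> w s n) has_real_derivative (u s * y' - y s * u') / ((u s)\<^sup>2 + (y s)\<^sup>2)) (at s)"
    by (rule angle_has_real_derivative[OF u' y' _ polar])
  then have "((\<lambda>s. - \<psi> w s n) has_real_derivative - ((u s * y' - y s * u') / ((u s)\<^sup>2 + (y s)\<^sup>2))) (at s)"
    by (rule DERIV_minus)
  then have "0 \<le> - ((u s * y' - y s * u') / ((u s)\<^sup>2 + (y s)\<^sup>2))"
  proof (rule mono_on_imp_deriv_nonneg[rotated])
    show "mono_on {0<..} (\<lambda>s. - \<psi> w s n)"
      using w by (intro mono_onI) (auto intro: pruefer_angle_mono)
    show "s \<in> interior {0<..}"
      using s half_space_pos by (simp add: interior_open)
  qed
  then have wronskian: "0 \<le> y s * u' - u s * y'"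
    using nonzero by (simp add: field_simps)
  have pos: "0 < s\<^sup>2 - p_inf\<^sup>2"
    using s half_space_pos power_strict_mono[of p_inf s 2] by simp
  have "(\<sigma> has_real_derivative s / \<sigma> s) (at s)"
    unfolding \<sigma>_def using pos by (auto intro!: derivative_eq_intros simp: field_simps)
  then have deriv: "(dispersion_real w has_real_derivative
      mu_inf * (s / \<sigma> s) * u s + mu_inf * \<sigma> s * u' - w * y') (at s)"
    unfolding disp[abs_def] by (auto intro!: derivative_eq_intros u' y' simp: algebra_simps)
  have root: "mu_inf * \<sigma> s * u s = w * y s"
    using zero by (simp add: disp)
  have "u s \<noteq> 0"
    using root w nonzero by auto
  then have "0 < mu_inf * (s / \<sigma> s) * (u s)\<^sup>2"
    using pos s half_space_pos by (auto simp: \<sigma>_def)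
  also have "\<dots> \<le> mu_inf * (s / \<sigma> s) * (u s)\<^sup>2 + w * (y s * u' - u s * y')"
    using wronskian w by simp
  also have "\<dots> = u s * (mu_inf * (s / \<sigma> s) * u s + mu_inf * \<sigma> s * u' - w * y')"
    using root by algebra
  finally have "mu_inf * (s / \<sigma> s) * u s + mu_inf * \<sigma> s * u' - w * y' \<noteq> 0"
    by (metis less_irrefl mult_zero_right)
  with deriv show ?thesis
    by (rule that)
qed

text \<open>
  The point where the phase equals \<open>j \<pi>\<close>; it exists if and only if the phase at the slowness of the half-space is
  at least \<open>j \<pi>\<close>. The phase decreases in the slowness, so \<open>j = 0\<close> gives the largest root.
\<close>

definition root :: "nat \<Rightarrow> real \<Rightarrow> real" where
  "root j w = (THE s. s \<in> {p_inf..<q} \<and> phase w s = of_nat j * pi)"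

lemma root_unique:
  assumes "0 < w" "s \<in> {p_inf..<q}" "phase w s = of_nat j * pi"
  shows "root j w = s"
  unfolding root_def
proof (rule the_equality)
  fix s' assume "s' \<in> {p_inf..<q} \<and> phase w s' = of_nat j * pi"
  then show "s' = s"
    using assms phase_strict_antimono[of w s s'] phase_strict_antimono[of w s' s] 
    by (cases s s' rule: linorder_cases) auto
qed (use assms in simp)

lemma root:
  assumes w: "0 < w" and j: "of_nat j * pi \<le> phase w p_inf"
  shows "root j w \<in> {p_inf..<q}" "phase w (root j w) = of_nat j * pi"
proof -
  have below: "phase w q < of_nat j * pi"
    using phase_at_q[OF w] pi_gt_zero by (smt (verit) greaterThanLessThan_iff mult_nonneg_nonneg of_nat_0_le_iff)
  have "continuous_on {p_inf..q} (phase w)"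
    using w by (intro continuous_intros) auto
  then obtain s where s: "p_inf \<le> s" "s \<le> q" "phase w s = of_nat j * pi"
    using IVT2'[of "phase w" q "of_nat j * pi" p_inf] below j p_less_q by auto
  then have "s \<in> {p_inf..<q}"
    using below by (cases "s = q") auto
  with s root_unique[OF w] show "root j w \<in> {p_inf..<q}" "phase w (root j w) = of_nat j * pi"
    by auto
qed

lemma root_strict_antimono:
  assumes w: "0 < w" and "i < j" and j: "of_nat j * pi \<le> phase w p_inf"
  shows "root j w < root i w"
proof -
  have less: "of_nat i * pi < of_nat j * pi"
    using assms(2) by simp
  then have i: "of_nat i * pi \<le> phase w p_inf"
    using j by linarith
  have "phase w (root i w) < phase w (root j w)"
    using root(2)[OF w i] root(2)[OF w j] less by simp
  then show ?thesis
    using phase_strict_antimono[OF w, of "root i w" "root j w"] root(1)[OF w i]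
    by (cases "root i w" "root j w" rule: linorder_cases) auto
qed

lemma roots_eq:
  assumes w: "0 < w"
  shows "{s \<in> {p_inf..<q}. dispersion_real w s = 0}
    = (\<lambda>j. root j w) ` {j. of_nat j * pi \<le> phase w p_inf}"
proof (intro equalityI subsetI)
  fix s assume "s \<in> {s \<in> {p_inf..<q}. dispersion_real w s = 0}"
  then obtain i :: int where s: "s \<in> {p_inf..<q}" and i: "phase w s = of_int i * pi"
    using dispersion_real_eq_0_iff[OF w] by auto
  have "phase w q < phase w s"
    using s by (intro phase_strict_antimono w) auto
  then have "(-1) * pi < of_int i * pi"
    using phase_at_q[OF w] i by simp
  then have "- 1 < i"
    by (simp only: mult_less_cancel_right_pos[OF pi_gt_zero])
  then have j: "phase w s = of_nat (nat i) * pi"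
    using i by simp
  moreover have "phase w s \<le> phase w p_inf"
    using s phase_strict_antimono[OF w, of p_inf s] by (cases "s = p_inf") auto
  ultimately show "s \<in> (\<lambda>j. root j w) ` {j. of_nat j * pi \<le> phase w p_inf}"
    using root_unique[OF w s j] by (intro image_eqI[of _ _ "nat i"]) auto
next
  fix s assume "s \<in> (\<lambda>j. root j w) ` {j. of_nat j * pi \<le> phase w p_inf}"
  then obtain j where j: "of_nat j * pi \<le> phase w p_inf" "s = root j w"
    by blast
  then have "phase w s = of_int (int j) * pi"
    using root(2)[OF w j(1)] by simp
  then show "s \<in> {s \<in> {p_inf..<q}. dispersion_real w s = 0}"
    using root(1)[OF w j(1)] j(2) dispersion_real_eq_0_iff[OF w] by blast
qed

text \<open>
  The frequency above which the root lies strictly above the slowness of the half-space.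
\<close>

definition cutoff :: "nat \<Rightarrow> real" where
  "cutoff m = Inf {w. 0 < w \<and> of_nat m * pi < phase w p_inf}"

lemma cutoff_bounds:
  "{w. 0 < w \<and> of_nat m * pi < phase w p_inf} \<noteq> {}"
  "bdd_below {w. 0 < w \<and> of_nat m * pi < phase w p_inf}"
proof -
  show "{w. 0 < w \<and> of_nat m * pi < phase w p_inf} \<noteq> {}"
    using phase_unbounded[of p_inf "of_nat m * pi"] half_space_pos p_less_q by auto
  show "bdd_below {w. 0 < w \<and> of_nat m * pi < phase w p_inf}"
    by (rule bdd_belowI[of _ 0]) auto
qed

lemma cutoff_nonneg: "0 \<le> cutoff m"
  unfolding cutoff_def using cutoff_bounds(1) by (rule cInf_greatest) auto

text \<open>
  The frequencies in question form an up-set because the phase grows with \<open>w\<close>, and an open one because it is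
  continuous; so they are exactly those beyond their infimum.
\<close>

lemma above_cutoff_iff: "cutoff m < w \<longleftrightarrow> 0 < w \<and> of_nat m * pi < phase w p_inf"
proof
  assume "cutoff m < w"
  then obtain v where "0 < v" "of_nat m * pi < phase v p_inf" "v < w"
    unfolding cutoff_def using cInf_lessD[OF cutoff_bounds(1)] by blast
  then show "0 < w \<and> of_nat m * pi < phase w p_inf"
    using phase_mono[of v w p_inf] by simp
next
  assume w: "0 < w \<and> of_nat m * pi < phase w p_inf"
  have "continuous_on {0<..} (\<lambda>v. phase v p_inf)"
    by (intro continuous_intros) auto
  then have "isCont (\<lambda>v. phase v p_inf) w"
    using w by (simp add: continuous_on_eq_continuous_at)
  then have "((\<lambda>v. phase v p_inf) \<longlongrightarrow> phase w p_inf) (at_left w)"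
    unfolding isCont_def by (rule tendsto_within_subset) simp
  then have "\<forall>\<^sub>F v in at_left w. of_nat m * pi < phase v p_inf"
    using w by (intro order_tendstoD) auto
  moreover have "\<forall>\<^sub>F v in at_left w. v \<in> {0<..<w}"
    using w by (intro eventually_at_left_real) auto
  ultimately have "\<forall>\<^sub>F v in at_left w. v < w \<and> 0 < v \<and> of_nat m * pi < phase v p_inf"
    by eventually_elim auto
  then obtain v where "v < w" "0 < v" "of_nat m * pi < phase v p_inf"
    using eventually_happens trivial_limit_at_left_real by blast
  then show "cutoff m < w"
    unfolding cutoff_def using cutoff_bounds by (subst cInf_less_iff) auto
qed

lemma root_above_cutoff:
  assumes "cutoff m < w"
  shows "0 < w" "root m w \<in> {p_inf<..<q}" "phase w (root m w) = of_nat m * pi"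
proof -
  have w: "0 < w" "of_nat m * pi < phase w p_inf"
    using assms above_cutoff_iff by auto
  then have "root m w \<in> {p_inf..<q}" "phase w (root m w) = of_nat m * pi"
    using root by auto
  with w show "0 < w" "root m w \<in> {p_inf<..<q}" "phase w (root m w) = of_nat m * pi"
    by (auto simp: less_le)
qed

lemma strict_mono_on_root: "strict_mono_on {cutoff m<..} (root m)"
proof (rule strict_mono_onI)
  fix v w assume "v \<in> {cutoff m<..}" "w \<in> {cutoff m<..}" "v < w"
  then have v: "cutoff m < v" and w: "cutoff m < w"
    by auto
  note v = root_above_cutoff[OF v] and w = root_above_cutoff[OF w]
  have "phase w (root m w) = phase v (root m v)"
    using v w by simp
  also have "\<dots> < phase w (root m v)"
    using v by (intro phase_strict_mono \<open>v < w\<close>) auto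
  finally have "phase w (root m w) < phase w (root m v)" .
  then show "root m v < root m w"
    using phase_strict_antimono[OF w(1), of "root m w" "root m v"] w(2)
    by (cases "root m v" "root m w" rule: linorder_cases) auto
qed

text \<open>
  For fixed \<open>s\<close> the phase runs continuously from a negative value to one beyond \<open>m \<pi>\<close>, so some frequency has
  \<open>s\<close> as its root; strict monotonicity in the slowness places this frequency above the cutoff.
\<close>

lemma root_image: "root m ` {cutoff m<..} = {p_inf<..<q}"
proof (intro equalityI subsetI)
  fix s assume "s \<in> root m ` {cutoff m<..}"
  then show "s \<in> {p_inf<..<q}"
    using root_above_cutoff(2) by blast
next
  fix s assume s: "s \<in> {p_inf<..<q}"
  obtain v where v: "0 < v" "phase v s < 0"
    using phase_negative s by auto
  obtain v' where v': "0 < v'" "of_nat m * pi < phase v' s"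
    using phase_unbounded[of s "of_nat m * pi"] s half_space_pos by auto
  have v_lt: "phase v s < of_nat m * pi"
    using v(2) pi_gt_zero by (smt (verit) mult_nonneg_nonneg of_nat_0_le_iff)
  then have "v < v'"
    using v' v phase_mono[of v' v s] s by (cases v v' rule: linorder_cases) auto
  moreover have "continuous_on {v..v'} (\<lambda>w. phase w s)"
    using v by (intro continuous_intros) auto
  ultimately obtain w where w: "v \<le> w" "phase w s = of_nat m * pi"
    using IVT'[of "\<lambda>w. phase w s" v "of_nat m * pi" v'] v' v_lt by auto
  have "0 < w"
    using v w by simp
  then have "phase w s < phase w p_inf"
    using s by (intro phase_strict_antimono) auto
  then have "w \<in> {cutoff m<..}"
    using above_cutoff_iff \<open>0 < w\<close> w(2) by auto
  moreover have "root m w = s"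
    using s w \<open>0 < w\<close> by (intro root_unique) auto
  ultimately show "s \<in> root m ` {cutoff m<..}"
    by blast
qed

text \<open>
  The root is continuous, being monotone onto an interval, so near \<open>w0\<close> its graph stays in the neighbourhood where
  the zeros of the complex dispersion function are those of a holomorphic function of \<open>w\<close>.
\<close>

lemma real_analytic_on_root: "real_analytic_on (root m) {cutoff m<..}"
  unfolding real_analytic_on_def
proof
  fix w0 assume w0: "w0 \<in> {cutoff m<..}"
  define s0 where "s0 = root m w0"
  have props: "0 < w" "root m w \<in> {p_inf<..<q}" "dispersion_real w (root m w) = 0"
    if "cutoff m < w" for w
  proof -
    note above = root_above_cutoff[OF that]
    show "0 < w" "root m w \<in> {p_inf<..<q}"
      by fact+
    have "phase w (root m w) = of_int (int m) * pi"
      using above(3) by simp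
    then show "dispersion_real w (root m w) = 0"
      unfolding dispersion_real_eq_0_iff[OF above(1)] by blast
  qed
  have s0: "0 < w0" "p_inf < s0" "s0 < q" "dispersion_real w0 s0 = 0"
    using props w0 by (auto simp: s0_def)
  let ?U = "{z. (snd z)\<^sup>2 - of_real (p_inf\<^sup>2) \<notin> \<real>\<^sub>\<le>\<^sub>0} :: (complex \<times> complex) set"
  let ?z = "(complex_of_real w0, complex_of_real s0)"
  have "open ?U"
  proof -
    have "?U = (\<lambda>z. (snd z)\<^sup>2 - of_real (p_inf\<^sup>2)) -` (- \<real>\<^sub>\<le>\<^sub>0)"
      by auto
    then show ?thesis
      by (simp only:) (intro open_vimage continuous_intros open_Compl closed_nonpos_Reals_complex)
  qed
  moreover have "?z \<in> ?U"
  proof -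
    have "p_inf\<^sup>2 < s0\<^sup>2"
      using s0 half_space_pos by (intro power_strict_mono) auto
    then have "complex_of_real (s0\<^sup>2 - p_inf\<^sup>2) \<notin> \<real>\<^sub>\<le>\<^sub>0"
      by (simp add: complex_nonpos_Reals_iff del: of_real_diff of_real_power)
    then show ?thesis
      by simp
  qed
  moreover have "dispersion_complex ?z = 0"
    using s0 by (simp add: dispersion_complex_of_real)
  moreover obtain d where "((\<lambda>s. dispersion_complex (of_real w0, s)) has_field_derivative d) (at (of_real s0))" "d \<noteq> 0"
  proof -
    obtain F1 F2 where "\<forall>z\<in>?U. (dispersion_complex has_derivative (\<lambda>h. F1 z * fst h + F2 z * snd h)) (at z)"
      using holomorphic_dispersion_complex by (rule holomorphic_on2E)
    then have F': "(dispersion_complex has_derivative (\<lambda>h. F1 ?z * fst h + F2 ?z * snd h)) (at ?z)"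
      using \<open>?z \<in> ?U\<close> by blast
    have "((\<lambda>s. (complex_of_real w0, s)) has_derivative (\<lambda>h. (0, h))) (at (of_real s0))"
      by (auto intro!: derivative_eq_intros)
    from has_derivative_compose[OF this F']
    have complex: "((\<lambda>s. dispersion_complex (of_real w0, s)) has_field_derivative F2 ?z) (at (of_real s0))"
      by (simp add: has_field_derivative_def)
    obtain d where d: "(dispersion_real w0 has_real_derivative d) (at s0)" "d \<noteq> 0"
      using dispersion_real_simple_root s0 by blast
    \<comment> \<open>Along the real axis the complex derivative must agree with the real one, which is nonzero.\<close>
    have "((\<lambda>s. dispersion_complex (of_real w0, of_real s)) has_vector_derivative F2 ?z) (at s0)"
      using has_vector_derivative_real_field[OF complex] .
    moreover have "\<forall>\<^sub>F s in nhds s0. dispersion_complex (of_real w0, of_real s) = of_real (dispersion_real w0 s)"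
      using eventually_nhds_in_open[of "{p_inf<..}" s0] s0
      by (auto elim!: eventually_mono intro: dispersion_complex_of_real less_imp_le)
    ultimately have "((\<lambda>s. complex_of_real (dispersion_real w0 s)) has_vector_derivative F2 ?z) (at s0)"
      by (subst has_vector_derivative_cong_ev[symmetric, where f = "\<lambda>s. dispersion_complex (of_real w0, of_real s)" and S = UNIV])
        (use \<open>dispersion_complex ?z = 0\<close> s0(4) in \<open>auto elim: eventually_mono\<close>)
    moreover have "((\<lambda>s. complex_of_real (dispersion_real w0 s)) has_vector_derivative of_real d) (at s0)"
      by (rule has_vector_derivative_of_real) (use d in \<open>simp add: has_real_derivative_iff_has_vector_derivative\<close>)
    ultimately have "F2 ?z = of_real d"
      by (rule vector_derivative_unique_at)
    then show thesis
      using that[OF complex] d(2) by simp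
  qed
  ultimately obtain g V N where g: "open V" "of_real w0 \<in> V" "g holomorphic_on V" "open N" "?z \<in> N"
      "\<forall>w s. (w, s) \<in> N \<longrightarrow> dispersion_complex (w, s) = 0 \<longrightarrow> w \<in> V \<and> s = g w"
    by (rule holomorphic_implicit_function[OF holomorphic_dispersion_complex])
  have "continuous_on {cutoff m<..} (root m)"
    using strict_mono_on_leD[OF strict_mono_on_root]
    by (intro continuous_onI_mono) (auto simp: root_image)
  then have "continuous_on {cutoff m<..} (\<lambda>w. (complex_of_real w, complex_of_real (root m w)))"
    by (intro continuous_intros)
  then have "open ({cutoff m<..} \<inter> (\<lambda>w. (complex_of_real w, complex_of_real (root m w))) -` N)"
    using g(4) by (intro continuous_open_preimage) auto
  then have "\<forall>\<^sub>F w in nhds w0. w \<in> {cutoff m<..} \<inter> (\<lambda>w. (complex_of_real w, complex_of_real (root m w))) -` N"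
    by (rule eventually_nhds_in_open) (use w0 g(5) s0_def in auto)
  then have "\<forall>\<^sub>F w in nhds w0. complex_of_real (root m w) = g (of_real w)"
  proof eventually_elim
    case (elim w)
    then have "dispersion_complex (of_real w, of_real (root m w)) = 0"
      using props[of w] by (simp add: dispersion_complex_of_real less_imp_le)
    then show ?case
      using g(6) elim by auto
  qed
  with g show "\<exists>r>0. \<exists>a. \<forall>w. \<bar>w - w0\<bar> < r \<longrightarrow> (\<lambda>i. a i * (w - w0) ^ i) sums root m w"
    by (intro real_power_series_of_holomorphic)
qed

end

section \<open>From the medium to the layered system\<close>

lemma real_analytic_on_cong_open:
  assumes "real_analytic_on f S" "open S" "\<And>x. x \<in> S \<Longrightarrow> f x = g x"
  shows "real_analytic_on g S"
  unfolding real_analytic_on_def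
proof
  fix x assume x: "x \<in> S"
  obtain r a where r: "r > 0" "\<And>y. \<bar>y - x\<bar> < r \<Longrightarrow> (\<lambda>i. a i * (y - x) ^ i) sums f y"
    using assms(1) x unfolding real_analytic_on_def by metis
  obtain e where e: "e > 0" "ball x e \<subseteq> S"
    using assms(2) x openE by blast
  have "(\<lambda>i. a i * (y - x) ^ i) sums g y" if "\<bar>y - x\<bar> < min r e" for y
  proof -
    have "y \<in> ball x e"
      using that by (simp add: dist_real_def abs_minus_commute)
    then show ?thesis
      using r(2)[of y] that assms(3)[of y] e(2) by auto
  qed
  then show "\<exists>r>0. \<exists>a. \<forall>y. \<bar>y - x\<bar> < r \<longrightarrow> (\<lambda>i. a i * (y - x) ^ i) sums g y"
    using r(1) e(1) by (intro exI[of _ "min r e"] conjI exI[of _ a]) auto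
qed

lemma speed_pos:
  assumes "medium n H mu rho" "j \<in> {1..n+1}"
  shows "0 < speed mu rho j"
  using assms by (auto simp: medium_def speed_def)

lemma thickness_pos:
  assumes "medium n H mu rho" "j \<in> {1..n}"
  shows "0 < real_of_ereal (thickness H j)"
proof -
  have less: "H i < H (i + 1)" if "i \<in> {1..n+1}" for i
    using assms that unfolding medium_def by blast
  have nonneg: "0 \<le> H i" if "1 \<le> i" "i \<le> n + 1" for i
    using that
  proof (induction i rule: dec_induct)
    case base
    then show ?case
      using assms unfolding medium_def by simp
  next
    case (step i)
    then show ?case
      using less[of i] by simp
  qed
  have "H j < H (j + 1)" "H (j + 1) < H (j + 2)"
    using assms(2) less[of j] less[of "j + 1"] by auto
  moreover have "0 \<le> H j"
    using assms(2) nonneg by simp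
  ultimately show ?thesis
    unfolding thickness_def by (cases "H j"; cases "H (j + 1)") auto
qed

lemma layered_medium_of_medium:
  assumes medium: "medium n H mu rho" and contrast: "speed_min n mu rho < speed_inf n mu rho"
  shows "layered_medium n (\<lambda>j. real_of_ereal (thickness H j)) mu (\<lambda>j. 1 / speed mu rho j)
    (1 / speed_min n mu rho)"
proof
  have pos: "0 < speed mu rho j" if "j \<in> {1..n+1}" for j
    using speed_pos medium that by blast
  have fin: "finite (speed mu rho ` {1..n+1})" "speed mu rho ` {1..n+1} \<noteq> {}"
    by auto
  obtain i where i: "i \<in> {1..n+1}" "speed_min n mu rho = speed mu rho i"
    using Min_in[OF fin] unfolding speed_min_def by (metis imageE)
  show "0 < real_of_ereal (thickness H j)" if "j \<in> {1..n}" for j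
    using thickness_pos medium that by blast
  show "0 < mu j" if "j \<in> {1..n+1}" for j
    using medium that unfolding medium_def by blast
  show "0 < 1 / speed mu rho j" if "j \<in> {1..n+1}" for j
    using pos[OF that] by simp
  show "1 / speed mu rho j \<le> 1 / speed_min n mu rho" if "j \<in> {1..n+1}" for j
  proof (rule divide_left_mono)
    show "speed_min n mu rho \<le> speed mu rho j"
      unfolding speed_min_def using fin that by (intro Min_le) auto
    show "0 < speed mu rho j * speed_min n mu rho"
      using pos that i by (metis mult_pos_pos)
  qed simp
  have "i \<noteq> n + 1"
    using contrast i(2) unfolding speed_inf_def by auto
  then show "\<exists>j\<in>{1..n}. 1 / speed mu rho j = 1 / speed_min n mu rho"
    using i by (intro bexI[of _ i]) auto
  show "1 / speed mu rho (n + 1) < 1 / speed_min n mu rho"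
    using contrast pos[of "n + 1"] pos[OF i(1)] i(2) unfolding speed_inf_def
    by (intro divide_strict_left_mono) auto
qed

lemma nu_square:
  assumes "0 < w"
  shows "(nu mu rho w (w * s) j)\<^sup>2 = of_real (w\<^sup>2 * (s\<^sup>2 - (1 / speed mu rho j)\<^sup>2))"
proof -
  have "(sqrt_neg x)\<^sup>2 = of_real x" for x
    by (auto simp: sqrt_neg_def power_mult_distrib simp flip: of_real_power)
  then show ?thesis
    using assms by (simp add: nu_def power_mult_distrib power_divide)
qed

text \<open>
  The entries are even in \<open>\<nu>\<close>, so only \<open>\<nu>\<^sup>2\<close> matters, and at \<open>\<nu> = 0\<close> they take the prescribed limiting values.
\<close>

lemma transfer_entries:
  fixes \<nu> m T \<kappa> :: complex
  assumes "\<nu>\<^sup>2 = \<kappa>"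
  shows "(if \<nu> \<noteq> 0 then vector [vector [cosh (\<nu> * T), sinh (\<nu> * T) / (m * \<nu>)],
                             vector [m * \<nu> * sinh (\<nu> * T), cosh (\<nu> * T)]]
      else vector [vector [1, T / m], vector [0, 1]])
    = (vector [vector [cosh_sqrt (\<kappa> * T\<^sup>2), T * sinhc_sqrt (\<kappa> * T\<^sup>2) / m],
             vector [m * \<kappa> * (T * sinhc_sqrt (\<kappa> * T\<^sup>2)), cosh_sqrt (\<kappa> * T\<^sup>2)]] :: complex^2^2)"
proof -
  have arg: "\<kappa> * T\<^sup>2 = (\<nu> * T)\<^sup>2"
    using assms by (simp add: power_mult_distrib)
  have cosh: "cosh_sqrt (\<kappa> * T\<^sup>2) = cosh (\<nu> * T)"
    unfolding arg by (rule cosh_sqrt_square)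
  have sinh: "\<nu> * (T * sinhc_sqrt (\<kappa> * T\<^sup>2)) = sinh (\<nu> * T)"
    unfolding arg sinhc_sqrt_square[symmetric] by simp
  then have lower: "m * \<kappa> * (T * sinhc_sqrt (\<kappa> * T\<^sup>2)) = m * \<nu> * sinh (\<nu> * T)"
    unfolding assms[symmetric] sinh[symmetric] by (simp add: power2_eq_square)
  have upper: "T * sinhc_sqrt (\<kappa> * T\<^sup>2) / m = sinh (\<nu> * T) / (m * \<nu>)" if "\<nu> \<noteq> 0"
    unfolding sinh[symmetric] using that by simp
  show ?thesis
  proof (cases "\<nu> = 0")
    case True
    with assms show ?thesis
      by auto
  next
    case False
    then show ?thesis
      by (simp only: cosh lower upper[OF False]) simp
  qed
qed

lemma PQ_eq_wave_state:
  fixes H :: "nat \<Rightarrow> ereal" and mu rho :: "nat \<Rightarrow> real" and w s :: real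
  assumes "0 < w" "\<And>j. j \<in> {1..m} \<Longrightarrow> mu j \<noteq> 0"
  defines "state \<equiv> wave_state (\<lambda>j. real_of_ereal (thickness H j)) mu (\<lambda>j. 1 / speed mu rho j) w s"
  shows "PQ H mu rho w (w * s) m
    = vector [of_real (fst (state m)), of_real (- w\<^sup>2 * snd (state m))]"
  using assms(2)
proof (induction m)
  case 0
  then show ?case
    by (simp add: state_def)
next
  case (Suc m)
  define p where "p = 1 / speed mu rho (Suc m)"
  define T where "T = real_of_ereal (thickness H (Suc m))"
  define a where "a = w\<^sup>2 / mu (Suc m)"
  define b where "b = mu (Suc m) * (p\<^sup>2 - s\<^sup>2)"
  define \<kappa> where "\<kappa> = w\<^sup>2 * (s\<^sup>2 - p\<^sup>2)"
  have mu: "mu (Suc m) \<noteq> 0"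
    using Suc.prems by simp
  have ab: "- (a * b * T\<^sup>2) = \<kappa> * T\<^sup>2"
    using mu by (simp add: a_def b_def \<kappa>_def algebra_simps)
  obtain u y where uy: "state m = (u, y)"
    by (cases "state m")
  have state: "state (Suc m) = (layer_cos a b T * u - a * layer_sin a b T * y,
      b * layer_sin a b T * u + layer_cos a b T * y)"
    using uy unfolding state_def by (simp add: Let_def a_def b_def p_def T_def)
  have PQ: "PQ H mu rho w (w * s) m = vector [of_real u, of_real (- w\<^sup>2 * y)]"
    using Suc uy by simp
  have nu: "(nu mu rho w (w * s) (Suc m))\<^sup>2 = of_real \<kappa>"
    unfolding \<kappa>_def p_def by (rule nu_square[OF assms(1)])
  have arg: "complex_of_real \<kappa> * (of_real T)\<^sup>2 = of_real (- (a * b * T\<^sup>2))"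
    unfolding ab by simp
  have transfer: "transfer H mu rho w (w * s) (Suc m)
    = vector [vector [of_real (layer_cos a b T), of_real (layer_sin a b T / mu (Suc m))],
        vector [of_real (mu (Suc m) * \<kappa> * layer_sin a b T), of_real (layer_cos a b T)]]"
    unfolding transfer_def Let_def T_def[symmetric] transfer_entries[OF nu] arg
      cosh_sqrt_of_real sinhc_sqrt_of_real layer_cos_def layer_sin_def
    by simp
  have mult: "(vector [vector [c11, c12], vector [c21, c22]] :: complex^2^2) *v vector [x1, x2]
      = vector [c11 * x1 + c12 * x2, c21 * x1 + c22 * x2]" for c11 c12 c21 c22 x1 x2
    by (simp add: vec_eq_iff forall_2 matrix_vector_mult_def sum_2)
  have "layer_cos a b T * u + layer_sin a b T / mu (Suc m) * (- w\<^sup>2 * y) = fst (state (Suc m))"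
    using mu by (simp add: state a_def)
  moreover have "mu (Suc m) * \<kappa> * layer_sin a b T * u + layer_cos a b T * (- w\<^sup>2 * y)
      = - w\<^sup>2 * snd (state (Suc m))"
    by (simp add: state b_def \<kappa>_def algebra_simps)
  ultimately show ?case
    unfolding PQ.simps PQ transfer mult by (simp only: flip: of_real_mult of_real_add)
qed

theorem theorem1p1:
  fixes n l :: nat and H :: "nat \<Rightarrow> ereal" and mu rho :: "nat \<Rightarrow> real"
  assumes "medium n H mu rho"
    and "speed_min n mu rho < speed_inf n mu rho"
    and "1 \<le> l"
  shows "\<exists>\<omega>\<^sub>l::real. 0 \<le> \<omega>\<^sub>l \<and>
    (\<forall>\<omega>>\<omega>\<^sub>l. branch_defined n H mu rho l \<omega>) \<and>
    real_analytic_on (\<lambda>\<omega>. branch n H mu rho l \<omega> / \<omega>) {\<omega>\<^sub>l<..} \<and>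
    bij_betw (\<lambda>\<omega>. branch n H mu rho l \<omega> / \<omega>) {\<omega>\<^sub>l<..}
      {1 / speed_inf n mu rho <..< 1 / speed_min n mu rho} \<and>
    strict_mono_on {\<omega>\<^sub>l<..} (\<lambda>\<omega>. branch n H mu rho l \<omega> / \<omega>)"
proof -
  define T where "T j = real_of_ereal (thickness H j)" for j
  define p where "p j = 1 / speed mu rho j" for j
  define q where "q = 1 / speed_min n mu rho"
  interpret layered_medium n T mu p q
    using layered_medium_of_medium[OF assms(1,2)] unfolding T_def p_def q_def .
  have p_inf: "p_inf = 1 / speed_inf n mu rho"
    by (simp add: p_def speed_inf_def)
  \<comment> \<open>Branches are counted from 1 but phase levels from 0.\<close>
  define m where "m = l - 1"
  have dispersion: "dispersion n H mu rho w (w * s) = of_real (w * dispersion_real w s)"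
    if w: "0 < w" and s: "p_inf \<le> s" for w s
  proof -
    have "p_inf\<^sup>2 \<le> s\<^sup>2"
      using s half_space_pos by (intro power_mono) auto
    then have "nu mu rho w (w * s) (n + 1) = of_real (w * sqrt (s\<^sup>2 - p_inf\<^sup>2))"
      using w by (simp add: nu_def sqrt_neg_def p_def power_mult_distrib power_divide)
    moreover have "PQ H mu rho w (w * s) n = vector [of_real (fst (wave_state T mu p w s n)),
        of_real (- w\<^sup>2 * snd (wave_state T mu p w s n))]"
      unfolding T_def p_def using w mu_pos by (intro PQ_eq_wave_state) force+
    ultimately show ?thesis
      by (simp add: dispersion_def dispersion_real_def algebra_simps power2_eq_square)
  qed
  have wavenumbers: "wavenumbers n H mu rho w
      = (\<lambda>j. w * root j w) ` {j. of_nat j * pi \<le> phase w p_inf}" if w: "0 < w" for w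
  proof -
    have "wavenumbers n H mu rho w = (\<lambda>s. w * s) ` {s \<in> {p_inf..<q}. dispersion_real w s = 0}"
    proof (intro equalityI subsetI)
      fix k assume "k \<in> wavenumbers n H mu rho w"
      then have k: "w * p_inf \<le> k" "k < w * q" "dispersion n H mu rho w (w * (k / w)) = 0"
        using w unfolding wavenumbers_def p_inf q_def by auto
      then have "k / w \<in> {p_inf..<q}"
        using w by (auto simp: field_simps)
      moreover from this have "dispersion_real w (k / w) = 0"
        using dispersion[OF w, of "k / w"] k(3) w by simp
      ultimately show "k \<in> (\<lambda>s. w * s) ` {s \<in> {p_inf..<q}. dispersion_real w s = 0}"
        using w by (intro image_eqI[of _ _ "k / w"]) auto
    next
      fix k assume "k \<in> (\<lambda>s. w * s) ` {s \<in> {p_inf..<q}. dispersion_real w s = 0}"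
      then obtain s where s: "k = w * s" "s \<in> {p_inf..<q}" "dispersion_real w s = 0"
        by blast
      then have "w * p_inf \<le> k" "k < w * q"
        using w by auto
      then show "k \<in> wavenumbers n H mu rho w"
        using s dispersion[OF w, of s] unfolding wavenumbers_def p_inf q_def by auto
    qed
    then show ?thesis
      by (simp only: roots_eq[OF w] image_image)
  qed
  have main: "branch_defined n H mu rho l w" "branch n H mu rho l w / w = root m w"
    if above: "w \<in> {cutoff m<..}" for w
  proof -
    have w: "0 < w" and m: "of_nat m * pi < phase w p_inf"
      using above above_cutoff_iff by auto
    \<comment> \<open>The roots at frequency \<open>w\<close> are those with indices \<open>0, \<dots>, M\<close>.\<close>
    define M where "M = nat \<lfloor>phase w p_inf / pi\<rfloor>"
    have "0 \<le> phase w p_inf"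
      using m by (smt (verit) mult_nonneg_nonneg of_nat_0_le_iff pi_gt_zero)
    then have M: "of_nat j * pi \<le> phase w p_inf \<longleftrightarrow> j \<le> M" for j
      unfolding M_def by (simp add: le_nat_iff le_floor_iff field_simps)
    have set: "wavenumbers n H mu rho w = (\<lambda>j. w * root j w) ` {..M}"
      unfolding wavenumbers[OF w] M by (simp only: atMost_def)
    have decreasing: "w * root j w < w * root i w" if "i < j" "j \<le> M" for i j
      using that root_strict_antimono[OF w, of i j] w M by simp
    have "m \<le> M"
      using m M[of m] by linarith
    then have "branch n H mu rho l w = w * root m w"
      unfolding branch_def set m_def[symmetric]
      by (intro nth_rev_sorted_list_of_set_image decreasing)
    then show "branch n H mu rho l w / w = root m w"
      using w by simp
    have "inj_on (\<lambda>j. w * root j w) {..M}"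
      by (rule inj_onI) (metis atMost_iff decreasing less_irrefl linorder_neqE_nat)
    then have "card (wavenumbers n H mu rho w) = Suc M"
      unfolding set by (simp add: card_image)
    then show "branch_defined n H mu rho l w"
      using \<open>m \<le> M\<close> assms(3) unfolding branch_defined_def by (simp add: set m_def)
  qed
  show ?thesis
  proof (intro exI[of _ "cutoff m"] conjI allI impI)
    show "0 \<le> cutoff m"
      by (rule cutoff_nonneg)
    show "branch_defined n H mu rho l w" if "cutoff m < w" for w
      using main(1) that by simp
    show "real_analytic_on (\<lambda>w. branch n H mu rho l w / w) {cutoff m<..}"
      by (rule real_analytic_on_cong_open[OF real_analytic_on_root]) (use main(2) in auto)
    have "bij_betw (root m) {cutoff m<..} {p_inf<..<q}"
      using strict_mono_on_imp_inj_on[OF strict_mono_on_root] root_image by (rule bij_betw_imageI)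
    then show "bij_betw (\<lambda>w. branch n H mu rho l w / w) {cutoff m<..}
        {1 / speed_inf n mu rho <..< 1 / speed_min n mu rho}"
      using main(2) unfolding p_inf q_def by (subst bij_betw_cong)
    show "strict_mono_on {cutoff m<..} (\<lambda>w. branch n H mu rho l w / w)"
      using strict_mono_on_root main(2) by (simp add: strict_mono_on_def)
  qed
qed

end
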